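(* Let $\pi_{XY}:Y\to X$ be a configuration bundle over an oriented $(n+1)$-dimensional manifold $X$, let $\mathcal L:J^rY\to\Lambda^{n+1}X$ be an $r$-th order Lagrangian density (not assumed to be covariant under any group), and suppose there is a group embedding $\operatorname{Diff}(X)\to\operatorname{Aut}(Y)$, $\sigma\mapsto\sigma_Y$, with $\sigma_Y$ covering $\sigma$ and with the fields of differential index $k$. Let $\tilde Y=(X\times\bar X)\times_X Y$ with $\bar X=X$, and let $\tilde{\mathcal L}$ be the Lagrangian density on $J^{k+r}\tilde Y$ defined, for $\eta\in\operatorname{Diff}(X)$ and $\phi$ a section of $Y$, by $$\tilde{\mathcal L}\big(j^{k+r}(\eta,\phi)(x)\big)=\eta^*\Big[\mathcal L\big(j^r(\eta_Y\circ\phi\circ\eta^{-1})(\eta(x))\big)\Big].$$ Then the modified field theory on $J^{k+r}\tilde Y$ with Lagrangian density $\tilde{\mathcal L}$ is $\operatorname{Diff}(X)$-covariant with respect to the action of $\operatorname{Diff}(X)$ on $\tilde Y$ given by $\sigma_{\tilde Y}(x,\bar x,y)=(\sigma(x),\bar x,\sigma_Y(y))$; that is, for every $\sigma\in\operatorname{Diff}(X)$ and every $\gamma=j^{k+r}(\eta,\phi)(x)$, $$\tilde{\mathcal L}\big(j^{k+r}\sigma_{\tilde Y}(\gamma)\big)=\sigma_*\big[\tilde{\mathcal L}(\gamma)\big].$$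
   Context: All objects are smooth. $J^rY$ is the $r$-th jet bundle of $Y\to X$, $\Lambda^{n+1}X$ is the bundle of top forms on $X$, and a Lagrangian density is a bundle map $J^rY\to\Lambda^{n+1}X$ over $X$. $\operatorname{Aut}(Y)$ is the group of bundle automorphisms of $Y\to X$ (covering arbitrary diffeomorphisms of $X$); such an automorphism acts on jets by prolongation, $j^r\sigma_Y(j^r\phi(x))=j^r(\sigma_Y\circ\phi\circ\sigma_X^{-1})(\sigma_X(x))$, where $\sigma_X$ is the diffeomorphism it covers. The fields have differential index $k$: for $y\in Y_x$, $\sigma_Y(y)$ depends on $\sigma$ only through its derivatives at $x$ up to order $k$ (smoothly). Consequently $\tilde{\mathcal L}$ depends only on the indicated $(k+r)$-jet. The covariance fields are diffeomorphisms $\eta:X\to\bar X$, where $\bar X=X$ is a second copy of $X$, regarded as sections $x\mapsto(x,\eta(x))$ of the product bundle $X\times\bar X\to X$ (projection to the first factor). Sections of $\tilde Y=(X\times\bar X)\times_XY$ are pairs $(\eta,\phi)$, and $\tilde{\mathcal L}$ is defined on the jets $j^{k+r}(\eta,\phi)(x)$ with $\eta$ a diffeomorphism. For a top form $\omega$ at the point $\eta(x)$, $\eta^*[\omega]$ is its pull-back to a top form at $x$; $\sigma_*$ is push-forward of top forms. The action on sections induced by $\sigma_{\tilde Y}$ is $\sigma\cdot(\eta,\phi)=(\eta\circ\sigma^{-1},\ \sigma_Y\circ\phi\circ\sigma^{-1})$.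
   Formalization: When k = r = 0 the formula for the modified density involves the first derivative of η and so need not define a function on 0-jets; in that case only, it is assumed that the modified density depends only on the (k+r)-jet of (η, φ). *)

theory Defs
  imports "HOL-Analysis.Analysis" "HOL-Algebra.Bij"
begin

section \<open>Smooth functions on Euclidean spaces with an arbitrary finite set of coordinates\<close>

text \<open>
  For a finite index set \<open>I\<close> the Euclidean space of dimension \<open>card I\<close> is \<^term>\<open>powertop_real I\<close>,
  whose points are the extensional functions on \<open>I\<close>.  Numbers of coordinates may therefore depend
  on parameters, which is needed for jets of variable order.
\<close>

definition pd :: "'i \<Rightarrow> (('i \<Rightarrow> real) \<Rightarrow> real) \<Rightarrow> ('i \<Rightarrow> real) \<Rightarrow> real" where
  "pd i f p = deriv (\<lambda>t. f (p(i := t))) (p i)"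

primrec iter_pd :: "'i list \<Rightarrow> (('i \<Rightarrow> real) \<Rightarrow> real) \<Rightarrow> ('i \<Rightarrow> real) \<Rightarrow> real" where
  "iter_pd [] f = f"
| "iter_pd (i # is) f = pd i (iter_pd is f)"

text \<open>Class \<open>C\<^sup>m\<close> on a set \<open>S\<close>, which is open in \<^term>\<open>powertop_real I\<close> in all uses below.\<close>

fun C_on :: "nat \<Rightarrow> 'i set \<Rightarrow> ('i \<Rightarrow> real) set \<Rightarrow> (('i \<Rightarrow> real) \<Rightarrow> real) \<Rightarrow> bool" where
  "C_on 0 I S f \<longleftrightarrow> continuous_map (subtopology (powertop_real I) S) euclideanreal f"
| "C_on (Suc m) I S f \<longleftrightarrow>
     continuous_map (subtopology (powertop_real I) S) euclideanreal f \<and>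
     (\<forall>i\<in>I. (\<forall>p\<in>S. (\<lambda>t. f (p(i := t))) differentiable (at (p i))) \<and> C_on m I S (pd i f))"

definition smooth_real_on :: "'i set \<Rightarrow> ('i \<Rightarrow> real) set \<Rightarrow> (('i \<Rightarrow> real) \<Rightarrow> real) \<Rightarrow> bool" where
  "smooth_real_on I S f \<longleftrightarrow> (\<forall>m. C_on m I S f)"


section \<open>Smooth manifolds and smooth maps\<close>

text \<open>A chart is a pair of a domain and a coordinate map; the atlas need not be maximal.\<close>

record ('a, 'i) manifold =
  mtop :: "'a topology"
  idx :: "'i set"
  atlas :: "('a set \<times> ('a \<Rightarrow> 'i \<Rightarrow> real)) set"

abbreviation pts :: "('a, 'i) manifold \<Rightarrow> 'a set" where
  "pts M \<equiv> topspace (mtop M)"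

definition smooth_manifold :: "('a, 'i) manifold \<Rightarrow> bool" where
  "smooth_manifold M \<longleftrightarrow>
     finite (idx M) \<and> Hausdorff_space (mtop M) \<and> second_countable (mtop M) \<and>
     pts M = (\<Union>(U, a)\<in>atlas M. U) \<and>
     (\<forall>(U, a)\<in>atlas M.
        openin (mtop M) U \<and> openin (powertop_real (idx M)) (a ` U) \<and>
        homeomorphic_map (subtopology (mtop M) U) (subtopology (powertop_real (idx M)) (a ` U)) a) \<and>
     (\<forall>(U, a)\<in>atlas M. \<forall>(V, b)\<in>atlas M. \<forall>j\<in>idx M.
        smooth_real_on (idx M) (a ` (U \<inter> V)) (\<lambda>p. b (inv_into U a p) j))"

definition smooth_map_on ::
  "('a, 'i) manifold \<Rightarrow> ('b, 'j) manifold \<Rightarrow> 'a set \<Rightarrow> ('a \<Rightarrow> 'b) \<Rightarrow> bool" where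
  "smooth_map_on M N W f \<longleftrightarrow>
     openin (mtop M) W \<and> continuous_map (subtopology (mtop M) W) (mtop N) f \<and>
     (\<forall>(U, a)\<in>atlas M. \<forall>(V, b)\<in>atlas N. \<forall>j\<in>idx N.
        smooth_real_on (idx M) (a ` {z \<in> U \<inter> W. f z \<in> V}) (\<lambda>p. b (f (inv_into U a p)) j))"

definition diffeo_on ::
  "('a, 'i) manifold \<Rightarrow> ('b, 'j) manifold \<Rightarrow> 'a set \<Rightarrow> 'b set \<Rightarrow> ('a \<Rightarrow> 'b) \<Rightarrow> bool" where
  "diffeo_on M N W W' f \<longleftrightarrow>
     bij_betw f W W' \<and> smooth_map_on M N W f \<and> smooth_map_on N M W' (inv_into W f)"

definition smooth_near :: "('a, 'i) manifold \<Rightarrow> 'a \<Rightarrow> ('a \<Rightarrow> real) set" where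
  "smooth_near M x = {f. \<exists>W. openin (mtop M) W \<and> x \<in> W \<and>
     (\<forall>(U, a)\<in>atlas M. smooth_real_on (idx M) (a ` (U \<inter> W)) (\<lambda>p. f (inv_into U a p)))}"

definition prod_manifold ::
  "('a, 'i) manifold \<Rightarrow> ('b, 'j) manifold \<Rightarrow> ('a \<times> 'b, 'i + 'j) manifold" where
  "prod_manifold M N =
     \<lparr>mtop = prod_topology (mtop M) (mtop N),
      idx = idx M <+> idx N,
      atlas = {(U \<times> V, \<lambda>(x, y). case_sum (a x) (b y)) | U a V b.
                 (U, a) \<in> atlas M \<and> (V, b) \<in> atlas N}\<rparr>"

text \<open>Group elements are extensional outside the manifold, as in \<^const>\<open>BijGroup\<close>.\<close>

definition Diff :: "('a, 'i) manifold \<Rightarrow> ('a \<Rightarrow> 'a) monoid" where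
  "Diff M = (BijGroup (pts M))
     \<lparr>carrier := {f \<in> Bij (pts M). diffeo_on M M (pts M) (pts M) f}\<rparr>"


section \<open>Fibre bundles and bundle automorphisms\<close>

definition fibre_bundle ::
  "('x, 'i) manifold \<Rightarrow> ('y, 'j) manifold \<Rightarrow> ('f, 'l) manifold \<Rightarrow> ('y \<Rightarrow> 'x) \<Rightarrow> bool" where
  "fibre_bundle X Y F \<pi> \<longleftrightarrow>
     smooth_manifold X \<and> smooth_manifold Y \<and> smooth_manifold F \<and>
     smooth_map_on Y X (pts Y) \<pi> \<and> \<pi> ` pts Y = pts X \<and>
     (\<forall>x\<in>pts X. \<exists>U t. openin (mtop X) U \<and> x \<in> U \<and>
        diffeo_on Y (prod_manifold X F) {y \<in> pts Y. \<pi> y \<in> U} (U \<times> pts F) t \<and>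
        (\<forall>y\<in>pts Y. \<pi> y \<in> U \<longrightarrow> fst (t y) = \<pi> y))"

definition covers ::
  "('y, 'j) manifold \<Rightarrow> ('y \<Rightarrow> 'x) \<Rightarrow> ('y \<Rightarrow> 'y) \<Rightarrow> ('x \<Rightarrow> 'x) \<Rightarrow> bool" where
  "covers Y \<pi> S s \<longleftrightarrow> (\<forall>y\<in>pts Y. \<pi> (S y) = s (\<pi> y))"

definition Aut ::
  "('x, 'i) manifold \<Rightarrow> ('y, 'j) manifold \<Rightarrow> ('y \<Rightarrow> 'x) \<Rightarrow> ('y \<Rightarrow> 'y) monoid" where
  "Aut X Y \<pi> = (Diff Y)
     \<lparr>carrier := {S \<in> carrier (Diff Y). \<exists>s\<in>carrier (Diff X). covers Y \<pi> S s}\<rparr>"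


section \<open>Top forms\<close>

text \<open>
  Tangent vectors at \<open>x\<close> are the linear combinations of the coordinate derivations at \<open>x\<close>, acting
  on the functions that are smooth near \<open>x\<close> (and extended by zero to all functions).
\<close>

type_synonym 'x tvec = "('x \<Rightarrow> real) \<Rightarrow> real"

definition coord_vec ::
  "('x, 'i) manifold \<Rightarrow> 'x set \<times> ('x \<Rightarrow> 'i \<Rightarrow> real) \<Rightarrow> 'x \<Rightarrow> 'i \<Rightarrow> 'x tvec" where
  "coord_vec X c x i = (case c of (U, a) \<Rightarrow>
     (\<lambda>f. if f \<in> smooth_near X x then pd i (\<lambda>p. f (inv_into U a p)) (a x) else 0))"

definition tangent_space :: "('x, 'i) manifold \<Rightarrow> 'x \<Rightarrow> 'x tvec set" where
  "tangent_space X x =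
     {v. \<exists>c\<in>atlas X. x \<in> fst c \<and> (\<exists>w. v = (\<lambda>f. \<Sum>i\<in>idx X. w i * coord_vec X c x i f))}"

definition push_vec :: "('x, 'i) manifold \<Rightarrow> ('x \<Rightarrow> 'x) \<Rightarrow> 'x \<Rightarrow> 'x tvec \<Rightarrow> 'x tvec" where
  "push_vec X s x v = (\<lambda>f. if f \<in> smooth_near X (s x) then v (f \<circ> s) else 0)"

text \<open>
  Top forms at \<open>x\<close>: alternating multilinear functions of \<open>dim X\<close> tangent vectors at \<open>x\<close>, extended
  by zero to all other lists so that equality of forms is equality of functions.
\<close>

type_synonym 'x form = "'x tvec list \<Rightarrow> real"

definition frames_at :: "('x, 'i) manifold \<Rightarrow> 'x \<Rightarrow> 'x tvec list set" where
  "frames_at X x = {vs. length vs = card (idx X) \<and> set vs \<subseteq> tangent_space X x}"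

definition top_forms :: "('x, 'i) manifold \<Rightarrow> 'x \<Rightarrow> 'x form set" where
  "top_forms X x = {\<omega>.
     (\<forall>vs. vs \<notin> frames_at X x \<longrightarrow> \<omega> vs = 0) \<and>
     (\<forall>vs\<in>frames_at X x. \<forall>m<length vs. \<forall>v\<in>tangent_space X x. \<forall>w\<in>tangent_space X x. \<forall>c d.
        \<omega> (vs[m := (\<lambda>f. c * v f + d * w f)]) = c * \<omega> (vs[m := v]) + d * \<omega> (vs[m := w])) \<and>
     (\<forall>vs\<in>frames_at X x. \<forall>l<length vs. \<forall>m<length vs. l \<noteq> m \<and> vs ! l = vs ! m \<longrightarrow> \<omega> vs = 0)}"

text \<open>The pull-back of \<open>\<omega>\<close>, a form at \<open>s x\<close>, to a form at \<open>x\<close>; push-forward is pull-back by the inverse.\<close>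

definition pull_form :: "('x, 'i) manifold \<Rightarrow> ('x \<Rightarrow> 'x) \<Rightarrow> 'x \<Rightarrow> 'x form \<Rightarrow> 'x form" where
  "pull_form X s x \<omega> = (\<lambda>vs. if vs \<in> frames_at X x then \<omega> (map (push_vec X s x) vs) else 0)"

definition push_form :: "('x, 'i) manifold \<Rightarrow> ('x \<Rightarrow> 'x) \<Rightarrow> 'x \<Rightarrow> 'x form \<Rightarrow> 'x form" where
  "push_form X s x \<omega> = pull_form X (inv_into (pts X) s) (s x) \<omega>"

text \<open>The coefficient of \<open>\<omega>\<close> with respect to the wedge product of the coordinate differentials.\<close>

definition form_coeff ::
  "('x, nat) manifold \<Rightarrow> 'x set \<times> ('x \<Rightarrow> nat \<Rightarrow> real) \<Rightarrow> 'x \<Rightarrow> 'x form \<Rightarrow> real" where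
  "form_coeff X c x \<omega> = \<omega> (map (coord_vec X c x) (sorted_list_of_set (idx X)))"

definition volume_form :: "('x, nat) manifold \<Rightarrow> ('x \<Rightarrow> 'x form) \<Rightarrow> bool" where
  "volume_form X \<mu> \<longleftrightarrow>
     (\<forall>x\<in>pts X. \<mu> x \<in> top_forms X x \<and> \<mu> x \<noteq> (\<lambda>_. 0)) \<and>
     (\<forall>(U, a)\<in>atlas X. smooth_real_on (idx X) (a ` U)
        (\<lambda>p. form_coeff X (U, a) (inv_into U a p) (\<mu> (inv_into U a p))))"

text \<open>An orientation is a class of nowhere vanishing top forms modulo positive functions.\<close>

definition orientation :: "('x, nat) manifold \<Rightarrow> ('x \<Rightarrow> 'x form) set \<Rightarrow> bool" where
  "orientation X Or \<longleftrightarrow> (\<exists>\<mu>. volume_form X \<mu> \<and>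
     Or = {\<nu>. volume_form X \<nu> \<and> (\<forall>x\<in>pts X. \<exists>c>0. \<nu> x = (\<lambda>vs. c * \<mu> x vs))})"


section \<open>Jets\<close>

definition same_jet ::
  "nat \<Rightarrow> ('x, 'i) manifold \<Rightarrow> ('y, 'j) manifold \<Rightarrow> ('x \<Rightarrow> 'y) \<Rightarrow> ('x \<Rightarrow> 'y) \<Rightarrow> 'x \<Rightarrow> bool" where
  "same_jet r X Y f g x \<longleftrightarrow> f x = g x \<and>
     (\<forall>(U, a)\<in>atlas X. \<forall>(V, b)\<in>atlas Y. x \<in> U \<and> f x \<in> V \<longrightarrow>
        (\<forall>is j. set is \<subseteq> idx X \<and> length is \<le> r \<and> j \<in> idx Y \<longrightarrow>
           iter_pd is (\<lambda>p. b (f (inv_into U a p)) j) (a x) =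
           iter_pd is (\<lambda>p. b (g (inv_into U a p)) j) (a x)))"

definition local_section ::
  "('x, 'i) manifold \<Rightarrow> ('y, 'j) manifold \<Rightarrow> ('y \<Rightarrow> 'x) \<Rightarrow> ('x \<Rightarrow> 'y) \<Rightarrow> 'x \<Rightarrow> bool" where
  "local_section X Y \<pi> \<phi> x \<longleftrightarrow>
     (\<exists>W. x \<in> W \<and> smooth_map_on X Y W \<phi> \<and> (\<forall>z\<in>W. \<pi> (\<phi> z) = z))"

text \<open>An \<open>r\<close>-jet of sections is a base point with an equivalence class of local sections.\<close>

type_synonym ('x, 'y) jet = "'x \<times> ('x \<Rightarrow> 'y) set"

definition jet ::
  "nat \<Rightarrow> ('x, 'i) manifold \<Rightarrow> ('y, 'j) manifold \<Rightarrow> ('y \<Rightarrow> 'x) \<Rightarrow> ('x \<Rightarrow> 'y) \<Rightarrow> 'x \<Rightarrow> ('x, 'y) jet" where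
  "jet r X Y \<pi> \<phi> x = (x, {\<psi>. local_section X Y \<pi> \<psi> x \<and> same_jet r X Y \<phi> \<psi> x})"

definition jet_space ::
  "nat \<Rightarrow> ('x, 'i) manifold \<Rightarrow> ('y, 'j) manifold \<Rightarrow> ('y \<Rightarrow> 'x) \<Rightarrow> ('x, 'y) jet set" where
  "jet_space r X Y \<pi> = {jet r X Y \<pi> \<phi> x | \<phi> x. x \<in> pts X \<and> local_section X Y \<pi> \<phi> x}"

definition prolong ::
  "nat \<Rightarrow> ('x, 'i) manifold \<Rightarrow> ('y, 'j) manifold \<Rightarrow> ('y \<Rightarrow> 'x) \<Rightarrow> ('y \<Rightarrow> 'y) \<Rightarrow> ('x \<Rightarrow> 'x) \<Rightarrow>
     ('x, 'y) jet \<Rightarrow> ('x, 'y) jet" where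
  "prolong r X Y \<pi> S s \<gamma> = (THE \<delta>. \<exists>\<phi> x. x \<in> pts X \<and> local_section X Y \<pi> \<phi> x \<and>
     \<gamma> = jet r X Y \<pi> \<phi> x \<and> \<delta> = jet r X Y \<pi> (S \<circ> \<phi> \<circ> inv_into (pts X) s) (s x))"

text \<open>
  Coordinates of \<open>r\<close>-jets of maps \<open>X \<rightarrow> Y\<close> in charts \<open>a\<close> of \<open>X\<close> and \<open>b\<close> of \<open>Y\<close>: the base coordinates
  and the partial derivatives of the components of the local representative.  Multi-indices are
  nondecreasing lists.
\<close>

definition jet_idx :: "nat \<Rightarrow> nat set \<Rightarrow> 'j set \<Rightarrow> (nat + 'j \<times> nat list) set" where
  "jet_idx r I J = I <+> (J \<times> {is. sorted is \<and> set is \<subseteq> I \<and> length is \<le> r})"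

definition jet_coords ::
  "nat \<Rightarrow> ('x, nat) manifold \<Rightarrow> ('y, 'j) manifold \<Rightarrow> 'x set \<times> ('x \<Rightarrow> nat \<Rightarrow> real) \<Rightarrow>
     ('y \<Rightarrow> 'j \<Rightarrow> real) \<Rightarrow> ('x \<Rightarrow> 'y) \<Rightarrow> 'x \<Rightarrow> (nat + 'j \<times> nat list) \<Rightarrow> real" where
  "jet_coords r X Y c b f x = (case c of (U, a) \<Rightarrow>
     restrict (case_sum (a x) (\<lambda>(j, is). iter_pd is (\<lambda>p. b (f (inv_into U a p)) j) (a x)))
       (jet_idx r (idx X) (idx Y)))"

text \<open>
  The jet bundle of sections is an embedded submanifold of the jet bundle of maps, so a function
  on it is smooth iff it is locally the restriction of a smooth function of these coordinates.
  The next two predicates express this: \<open>h\<close>, defined on a set \<open>D\<close> parametrised through coordinates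
  \<open>C\<close> (indexed by \<open>K\<close>), descends to a function of the coordinates which is smooth in this sense.
\<close>

definition smooth_real_in_coords ::
  "'k set \<Rightarrow> 'p set \<Rightarrow> ('p \<Rightarrow> 'k \<Rightarrow> real) \<Rightarrow> ('p \<Rightarrow> real) \<Rightarrow> bool" where
  "smooth_real_in_coords K D C h \<longleftrightarrow>
     (\<forall>p\<in>D. \<exists>B l. openin (powertop_real K) B \<and> C p \<in> B \<and> smooth_real_on K B l \<and>
        (\<forall>q\<in>D. C q \<in> B \<longrightarrow> h q = l (C q)))"

definition smooth_in_coords ::
  "'k set \<Rightarrow> 'p set \<Rightarrow> ('p \<Rightarrow> 'k \<Rightarrow> real) \<Rightarrow> ('b, 'j) manifold \<Rightarrow> ('p \<Rightarrow> 'b) \<Rightarrow> bool" where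
  "smooth_in_coords K D C N h \<longleftrightarrow>
     (\<forall>p\<in>D. \<forall>(V, b)\<in>atlas N. h p \<in> V \<longrightarrow>
        (\<exists>B l. openin (powertop_real K) B \<and> C p \<in> B \<and>
           (\<forall>j\<in>idx N. smooth_real_on K B (l j)) \<and>
           (\<forall>q\<in>D. C q \<in> B \<longrightarrow> h q \<in> V \<and> (\<forall>j\<in>idx N. b (h q) j = l j (C q)))))"


section \<open>Lagrangian densities and differential index\<close>

definition lagrangian_density ::
  "nat \<Rightarrow> ('x, nat) manifold \<Rightarrow> ('y, 'j) manifold \<Rightarrow> ('y \<Rightarrow> 'x) \<Rightarrow> (('x, 'y) jet \<Rightarrow> 'x form) \<Rightarrow> bool" where
  "lagrangian_density r X Y \<pi> L \<longleftrightarrow>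
     (\<forall>\<gamma>\<in>jet_space r X Y \<pi>. L \<gamma> \<in> top_forms X (fst \<gamma>)) \<and>
     (\<forall>(U, a)\<in>atlas X. \<forall>(V, b)\<in>atlas Y.
        smooth_real_in_coords (jet_idx r (idx X) (idx Y))
          {(\<phi>, x). x \<in> U \<and> local_section X Y \<pi> \<phi> x \<and> \<phi> x \<in> V}
          (\<lambda>(\<phi>, x). jet_coords r X Y (U, a) b \<phi> x)
          (\<lambda>(\<phi>, x). form_coeff X (U, a) x (L (jet r X Y \<pi> \<phi> x))))"

definition differential_index ::
  "nat \<Rightarrow> ('x, nat) manifold \<Rightarrow> ('y, 'j) manifold \<Rightarrow> ('y \<Rightarrow> 'x) \<Rightarrow> (('x \<Rightarrow> 'x) \<Rightarrow> 'y \<Rightarrow> 'y) \<Rightarrow> bool" where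
  "differential_index k X Y \<pi> A \<longleftrightarrow>
     (\<forall>\<sigma>\<in>carrier (Diff X). \<forall>\<tau>\<in>carrier (Diff X). \<forall>y\<in>pts Y.
        same_jet k X X \<sigma> \<tau> (\<pi> y) \<longrightarrow> A \<sigma> y = A \<tau> y) \<and>
     (\<forall>(U, a)\<in>atlas X. \<forall>(U', a')\<in>atlas X. \<forall>(V, b)\<in>atlas Y.
        smooth_in_coords (jet_idx k (idx X) (idx X) <+> idx Y)
          {(\<sigma>, y). \<sigma> \<in> carrier (Diff X) \<and> y \<in> V \<and> \<pi> y \<in> U \<and> \<sigma> (\<pi> y) \<in> U'}
          (\<lambda>(\<sigma>, y). case_sum (jet_coords k X X (U, a) a' \<sigma> (\<pi> y)) (b y))
          Y (\<lambda>(\<sigma>, y). A \<sigma> y))"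


section \<open>The modified field theory\<close>

text \<open>
  The fibre product of the trivial bundle \<open>X \<times> X \<rightarrow> X\<close> and \<open>Y\<close>.  Since \<open>x = \<pi> y\<close> on it, charts of
  the second copy of \<open>X\<close> and of \<open>Y\<close> provide its coordinates; its projection to \<open>X\<close> is \<^const>\<open>fst\<close>.
\<close>

definition Ytilde ::
  "('x, 'i) manifold \<Rightarrow> ('y, 'j) manifold \<Rightarrow> ('y \<Rightarrow> 'x) \<Rightarrow> ('x \<times> 'x \<times> 'y, 'i + 'j) manifold" where
  "Ytilde X Y \<pi> =
     \<lparr>mtop = subtopology (prod_topology (mtop X) (prod_topology (mtop X) (mtop Y)))
               {(x, xb, y). \<pi> y = x},
      idx = idx X <+> idx Y,
      atlas = {({(x, xb, y). xb \<in> U \<and> y \<in> V \<and> \<pi> y = x}, \<lambda>(x, xb, y). case_sum (a xb) (b y)) | U a V b.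
                 (U, a) \<in> atlas X \<and> (V, b) \<in> atlas Y}\<rparr>"

definition pair_section :: "('x \<Rightarrow> 'x) \<Rightarrow> ('x \<Rightarrow> 'y) \<Rightarrow> 'x \<Rightarrow> 'x \<times> 'x \<times> 'y" where
  "pair_section \<eta> \<phi> x = (x, \<eta> x, \<phi> x)"

definition act_tilde :: "(('x \<Rightarrow> 'x) \<Rightarrow> 'y \<Rightarrow> 'y) \<Rightarrow> ('x \<Rightarrow> 'x) \<Rightarrow> 'x \<times> 'x \<times> 'y \<Rightarrow> 'x \<times> 'x \<times> 'y" where
  "act_tilde A \<sigma> = (\<lambda>(x, xb, y). (\<sigma> x, xb, A \<sigma> y))"

definition covariantized ::
  "nat \<Rightarrow> ('x, 'i) manifold \<Rightarrow> ('y, 'j) manifold \<Rightarrow> ('y \<Rightarrow> 'x) \<Rightarrow> (('x \<Rightarrow> 'x) \<Rightarrow> 'y \<Rightarrow> 'y) \<Rightarrow>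
     (('x, 'y) jet \<Rightarrow> 'x form) \<Rightarrow> ('x \<Rightarrow> 'x) \<Rightarrow> ('x \<Rightarrow> 'y) \<Rightarrow> 'x \<Rightarrow> 'x form" where
  "covariantized r X Y \<pi> A L \<eta> \<phi> x =
     pull_form X \<eta> x (L (jet r X Y \<pi> (A \<eta> \<circ> \<phi> \<circ> inv_into (pts X) \<eta>) (\<eta> x)))"

definition Ltilde ::
  "nat \<Rightarrow> nat \<Rightarrow> ('x, 'i) manifold \<Rightarrow> ('y, 'j) manifold \<Rightarrow> ('y \<Rightarrow> 'x) \<Rightarrow> (('x \<Rightarrow> 'x) \<Rightarrow> 'y \<Rightarrow> 'y) \<Rightarrow>
     (('x, 'y) jet \<Rightarrow> 'x form) \<Rightarrow> ('x, 'x \<times> 'x \<times> 'y) jet \<Rightarrow> 'x form" where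
  "Ltilde k r X Y \<pi> A L \<gamma> = (THE \<omega>. \<exists>\<eta>\<in>carrier (Diff X). \<exists>\<phi> x.
     x \<in> pts X \<and> local_section X Y \<pi> \<phi> x \<and>
     \<gamma> = jet (k + r) X (Ytilde X Y \<pi>) fst (pair_section \<eta> \<phi>) x \<and>
     \<omega> = covariantized r X Y \<pi> A L \<eta> \<phi> x)"

text \<open>
  The pull-back of forms by \<open>\<eta>\<close> involves the first derivative of \<open>\<eta>\<close>.  Hence for \<open>k + r = 0\<close>, unlike
  for \<open>k + r > 0\<close>, it is not automatic that the defining expression depends only on the
  \<open>(k + r)\<close>-jet of \<open>(\<eta>, \<phi>)\<close>.
\<close>

definition depends_only_on_jet ::
  "nat \<Rightarrow> nat \<Rightarrow> ('x, 'i) manifold \<Rightarrow> ('y, 'j) manifold \<Rightarrow> ('y \<Rightarrow> 'x) \<Rightarrow> (('x \<Rightarrow> 'x) \<Rightarrow> 'y \<Rightarrow> 'y) \<Rightarrow>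
     (('x, 'y) jet \<Rightarrow> 'x form) \<Rightarrow> bool" where
  "depends_only_on_jet k r X Y \<pi> A L \<longleftrightarrow>
     (\<forall>\<eta>\<in>carrier (Diff X). \<forall>\<eta>'\<in>carrier (Diff X). \<forall>\<phi> \<phi>'. \<forall>x\<in>pts X.
        local_section X Y \<pi> \<phi> x \<and> local_section X Y \<pi> \<phi>' x \<and>
        jet (k + r) X (Ytilde X Y \<pi>) fst (pair_section \<eta> \<phi>) x =
        jet (k + r) X (Ytilde X Y \<pi>) fst (pair_section \<eta>' \<phi>') x \<longrightarrow>
        covariantized r X Y \<pi> A L \<eta> \<phi> x = covariantized r X Y \<pi> A L \<eta>' \<phi>' x)"

end

theory Submission
  imports Defs
begin

text \<open>
  The Lagrangian density is the pull-back by \<open>\<eta>\<close> of the original one, evaluated on fields transported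
  by \<open>\<eta>\<close>.  Moving \<open>(\<eta>, \<phi>)\<close> by \<open>\<sigma>\<close> replaces \<open>\<eta>\<close> by \<open>\<eta> \<circ> \<sigma>\<inverse>\<close> and \<open>\<phi>\<close> by \<open>\<sigma>\<^sub>Y \<circ> \<phi> \<circ> \<sigma>\<inverse>\<close>; since \<open>\<sigma> \<mapsto> \<sigma>\<^sub>Y\<close> is a
  homomorphism the transported field is unchanged, and functoriality of pull-back turns the pull-back
  by \<open>\<eta> \<circ> \<sigma>\<inverse>\<close> into the push-forward by \<open>\<sigma>\<close> of the pull-back by \<open>\<eta>\<close>.

  What needs work is that the expressions descend to jets.  This rests on one fact: the partial
  derivatives up to order \<open>r\<close> of a composite depend only on those of its factors.  Differential index
  \<open>k\<close> makes \<open>\<eta>\<^sub>Y \<circ> \<phi>\<close> locally a smooth function of \<open>\<phi>\<close> and the partial derivatives of \<open>\<eta>\<close> up to order \<open>k\<close>, so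
  its \<open>r\<close>-jet is determined by the \<open>(k + r)\<close>-jet of \<open>(\<eta>, \<phi>)\<close>.
\<close>

section \<open>Smooth functions and their jets in coordinates\<close>

text \<open>Two definite descriptions stand before the covariance computation: \<open>Ltilde\<close>
  selects a pair (\<eta>, \<phi>) with a given jet, and \<open>prolong\<close> selects any local
  section of the fibre product with that jet. Each has to be shown independent of the selection. The
  transported field contains the inverse of \<eta>, so jets of inverses must be controlled too;
  inversion and composition with diffeomorphisms keep the order of a jet. Pull-back of top forms
  uses one derivative of \<eta>, which the jet contains if k + r > 0.

  Coordinates are extensional functions on index sets that vary with k and r, and derivatives are
  one-variable derivatives along coordinate lines. The differential calculus is therefore built for
  exactly this setting. It is carried to manifolds through real-valued functions, so that components
  of maps and test functions of tangent vectors are treated by the same lemmas.\<close>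

abbreviation (input) opn :: "'i set \<Rightarrow> ('i \<Rightarrow> real) set \<Rightarrow> bool" where
  "opn I S \<equiv> openin (powertop_real I) S"

lemma opn_extensional: "opn I S \<Longrightarrow> p \<in> S \<Longrightarrow> p \<in> extensional I"
  by (drule openin_subset) (auto simp: PiE_def)

lemma fun_upd_extensional: "p \<in> extensional I \<Longrightarrow> i \<in> I \<Longrightarrow> p(i := t) \<in> extensional I"
  by (auto simp: extensional_def)

text \<open>A point of an open set has a product of open sets of reals around it; I is finite, so
  the least of the radii in the single coordinates is still positive.\<close>

lemma opn_box:
  assumes "finite I" "opn I S" "p \<in> S"
  obtains e where "e > 0"
    "\<And>q. q \<in> extensional I \<Longrightarrow> (\<And>i. i \<in> I \<Longrightarrow> \<bar>q i - p i\<bar> < e) \<Longrightarrow> q \<in> S"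
proof -
  obtain U where U: "\<forall>i\<in>I. open (U i)" "p \<in> Pi\<^sub>E I U" "Pi\<^sub>E I U \<subseteq> S"
    using assms(2,3) unfolding openin_product_topology_alt by (metis open_openin)
  have "\<exists>d>0. \<forall>t. \<bar>t - p i\<bar> < d \<longrightarrow> t \<in> U i" if "i \<in> I" for i
    using U(1,2) that unfolding open_dist dist_real_def by (auto simp: PiE_iff)
  then obtain d where d: "\<And>i. i \<in> I \<Longrightarrow> d i > 0 \<and> (\<forall>t. \<bar>t - p i\<bar> < d i \<longrightarrow> t \<in> U i)"
    by metis
  \<comment> \<open>The element 1 keeps the minimum meaningful when I is empty.\<close>
  define e where "e = Min (insert 1 (d ` I))"
  have "e > 0" using assms(1) d by (auto simp: e_def)
  moreover have "q \<in> S" if "q \<in> extensional I" "\<And>i. i \<in> I \<Longrightarrow> \<bar>q i - p i\<bar> < e" for q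
  proof -
    have "q i \<in> U i" if "i \<in> I" for i
    proof -
      have "e \<le> d i" using assms(1) that by (auto simp: e_def)
      with that show ?thesis using d \<open>\<And>i. i \<in> I \<Longrightarrow> \<bar>q i - p i\<bar> < e\<close> by fastforce
    qed
    then have "q \<in> Pi\<^sub>E I U" using that(1) by (auto simp: PiE_iff)
    then show ?thesis using U(3) by blast
  qed
  ultimately show ?thesis using that by blast
qed

text \<open>This is the reason why partial derivatives at a point of an open set depend only on the
  values in that set: the coordinate lines stay inside for a while.\<close>

lemma eventually_fun_upd_mem:
  assumes "finite I" "opn I S" "p \<in> S" "i \<in> I"
  shows "\<forall>\<^sub>F t in nhds (p i). p(i := t) \<in> S"
proof -
  obtain e where e: "e > 0"
    "\<And>q. q \<in> extensional I \<Longrightarrow> (\<And>i. i \<in> I \<Longrightarrow> \<bar>q i - p i\<bar> < e) \<Longrightarrow> q \<in> S"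
    using opn_box[OF assms(1-3)] by blast
  have "p \<in> extensional I" using opn_extensional assms by blast
  then have "p(i := t) \<in> S" if "dist t (p i) < e" for t
    using that e assms(4) by (auto simp: fun_upd_extensional dist_real_def)
  then show ?thesis using e(1) unfolding eventually_nhds_metric by blast
qed

lemma continuous_map_box:
  assumes "finite K" "opn K B" "q0 \<in> B"
    "continuous_map (subtopology (powertop_real K) B) euclideanreal h" "\<epsilon> > 0"
  obtains e where "e > 0"
    "\<And>q. q \<in> extensional K \<Longrightarrow> (\<And>k. k \<in> K \<Longrightarrow> \<bar>q k - q0 k\<bar> < e) \<Longrightarrow> q \<in> B \<and> \<bar>h q - h q0\<bar> < \<epsilon>"
proof -
  let ?T = "{q \<in> topspace (subtopology (powertop_real K) B). h q \<in> ball (h q0) \<epsilon>}"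
  have "opn K ?T"
    using openin_continuous_map_preimage[OF assms(4), of "ball (h q0) \<epsilon>"] assms(2)
    by (meson open_ball open_openin openin_trans_full)
  moreover have "q0 \<in> ?T" using assms(3,5) opn_extensional[OF assms(2,3)] by (auto simp: extensional_def)
  ultimately obtain e where "e > 0"
    "\<And>q. q \<in> extensional K \<Longrightarrow> (\<And>k. k \<in> K \<Longrightarrow> \<bar>q k - q0 k\<bar> < e) \<Longrightarrow> q \<in> ?T"
    using opn_box[OF assms(1)] by blast
  then show ?thesis using that[of e] by (auto simp: dist_real_def abs_minus_commute)
qed

section \<open>Locality of partial derivatives and of the classes C^m\<close>

lemma pd_cong:
  assumes "finite I" "opn I S" "\<And>p. p \<in> S \<Longrightarrow> f p = g p" "p \<in> S" "i \<in> I"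
  shows "pd i f p = pd i g p"
proof -
  have "\<forall>\<^sub>F t in nhds (p i). f (p(i := t)) = g (p(i := t))"
    using eventually_fun_upd_mem[OF assms(1,2,4,5)] by (rule eventually_mono) (rule assms(3))
  then show ?thesis unfolding pd_def by (rule deriv_cong_ev) simp
qed

lemma iter_pd_cong:
  assumes "finite I" "opn I S" "\<And>p. p \<in> S \<Longrightarrow> f p = g p" "set is \<subseteq> I" "p \<in> S"
  shows "iter_pd is f p = iter_pd is g p"
  using assms(4,5)
proof (induction "is" arbitrary: p)
  case (Cons i js)
  then show ?case using pd_cong[OF assms(1,2), of "iter_pd js f" "iter_pd js g" p i] by simp
qed (use assms in auto)

lemma iter_pd_append: "iter_pd (is @ js) f = iter_pd is (iter_pd js f)"
  by (induction "is") auto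

lemma C_on_continuous: "C_on m I S f \<Longrightarrow> continuous_map (subtopology (powertop_real I) S) euclideanreal f"
  by (cases m) auto

lemma C_on_Suc_imp: "C_on (Suc m) I S f \<Longrightarrow> C_on m I S f"
  by (induction m arbitrary: f) auto

lemma C_on_cong:
  assumes "finite I" "opn I S" "\<And>p. p \<in> S \<Longrightarrow> f p = g p" "C_on m I S f"
  shows "C_on m I S g"
  using assms(3,4)
proof (induction m arbitrary: f g)
  case 0
  then show ?case by (auto elim!: continuous_map_eq)
next
  case (Suc m)
  have "continuous_map (subtopology (powertop_real I) S) euclideanreal g"
    using Suc.prems by (auto elim!: continuous_map_eq)
  moreover have "(\<lambda>t. g (p(i := t))) differentiable (at (p i))" if "i \<in> I" "p \<in> S" for i p
  proof -
    have "\<forall>\<^sub>F t in nhds (p i). f (p(i := t)) = g (p(i := t))"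
      using eventually_fun_upd_mem[OF assms(1,2) that(2,1)]
      by (rule eventually_mono) (rule Suc.prems(1))
    then have "((\<lambda>t. f (p(i := t))) has_real_derivative D) (at (p i)) \<longleftrightarrow>
      ((\<lambda>t. g (p(i := t))) has_real_derivative D) (at (p i))" for D
      by (intro DERIV_cong_ev) auto
    then show ?thesis using Suc.prems(2) that by (metis C_on.simps(2) real_differentiable_def)
  qed
  moreover have "C_on m I S (pd i g)" if "i \<in> I" for i
    using Suc.IH[of "pd i f" "pd i g"] Suc.prems that pd_cong[OF assms(1,2)] by (metis C_on.simps(2))
  ultimately show ?case by auto
qed

lemma C_on_subset: "C_on m I S f \<Longrightarrow> T \<subseteq> S \<Longrightarrow> C_on m I T f"
  by (induction m arbitrary: f) (auto elim: continuous_map_from_subtopology_mono)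

text \<open>Differentiability is demanded point by point of the total function f, so it passes from
  the pieces to S at once. Continuity is glued by the pasting lemma along relatively open pieces,
  which works for arbitrary S.\<close>

lemma C_on_local:
  assumes "\<And>p. p \<in> S \<Longrightarrow> \<exists>T. opn I T \<and> p \<in> T \<and> C_on m I (S \<inter> T) f"
  shows "C_on m I S f"
  using assms
proof (induction m arbitrary: f)
  case 0
  let ?X = "subtopology (powertop_real I) S"
  obtain T where T: "\<And>p. p \<in> S \<Longrightarrow> opn I (T p) \<and> p \<in> T p \<and> C_on 0 I (S \<inter> T p) f"
    using 0 by metis
  have "continuous_map ?X euclideanreal f"
  proof (rule pasting_lemma[where I = S and T = "\<lambda>p. S \<inter> T p" and f = "\<lambda>_. f"])
    show "openin ?X (S \<inter> T p)" if "p \<in> S" for p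
      using T[OF that] by (auto simp: openin_subtopology_Int2)
    show "continuous_map (subtopology ?X (S \<inter> T p)) euclideanreal f" if "p \<in> S" for p
      using T[OF that] by (auto simp: subtopology_subtopology Int_assoc)
  qed (use T in auto)
  then show ?case by simp
next
  case (Suc m)
  have "C_on m I S f" using Suc C_on_Suc_imp by meson
  then have "continuous_map (subtopology (powertop_real I) S) euclideanreal f"
    by (rule C_on_continuous)
  moreover have "C_on m I S (pd i f)" if "i \<in> I" for i
    by (rule Suc.IH) (use Suc.prems that in fastforce)
  moreover have "(\<lambda>t. f (p(i := t))) differentiable (at (p i))" if "i \<in> I" "p \<in> S" for i p
    using Suc.prems that by fastforce
  ultimately show ?case by simp
qed

lemma C_on_has_derivative:
  assumes "C_on (Suc m) I S f" "p \<in> S" "i \<in> I"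
  shows "((\<lambda>t. f (p(i := t))) has_real_derivative pd i f p) (at (p i))"
proof -
  obtain D where "((\<lambda>t. f (p(i := t))) has_real_derivative D) (at (p i))"
    using assms by (auto simp: real_differentiable_def)
  then show ?thesis by (metis DERIV_imp_deriv pd_def)
qed

text \<open>Pattern shared with products and composites: a one-variable rule computes
  \<open>pd i\<close> on S, the induction hypothesis treats the resulting formula, and
  \<open>C_on_cong\<close> carries it back, since formula and derivative are known to agree on S
  only.\<close>

lemma C_on_add:
  assumes "finite I" "opn I S" "C_on m I S f" "C_on m I S g"
  shows "C_on m I S (\<lambda>p. f p + g p)"
  using assms(3,4)
proof (induction m arbitrary: f g)
  case (Suc m)
  have d: "((\<lambda>t. f (p(i := t)) + g (p(i := t))) has_real_derivative pd i f p + pd i g p) (at (p i))"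
    if "i \<in> I" "p \<in> S" for i p
    using C_on_has_derivative[OF Suc.prems(1) that(2,1)] C_on_has_derivative[OF Suc.prems(2) that(2,1)]
    by (rule DERIV_add)
  have "C_on m I S (pd i (\<lambda>p. f p + g p))" if "i \<in> I" for i
  proof (rule C_on_cong[OF assms(1,2)])
    show "C_on m I S (\<lambda>p. pd i f p + pd i g p)" using Suc that by simp
    show "pd i f p + pd i g p = pd i (\<lambda>p. f p + g p) p" if "p \<in> S" for p
      using DERIV_imp_deriv[OF d[OF \<open>i \<in> I\<close> that]] by (simp add: pd_def)
  qed
  with d show ?case using Suc.prems by (auto simp: real_differentiable_def intro!: continuous_map_add)
qed (auto intro!: continuous_map_add)

lemma C_on_mult:
  assumes "finite I" "opn I S" "C_on m I S f" "C_on m I S g"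
  shows "C_on m I S (\<lambda>p. f p * g p)"
  using assms(3,4)
proof (induction m arbitrary: f g)
  case (Suc m)
  have d: "((\<lambda>t. f (p(i := t)) * g (p(i := t))) has_real_derivative pd i f p * g p + pd i g p * f p) (at (p i))"
    if "i \<in> I" "p \<in> S" for i p
    using DERIV_mult[OF C_on_has_derivative[OF Suc.prems(1) that(2,1)] C_on_has_derivative[OF Suc.prems(2) that(2,1)]]
    unfolding fun_upd_triv .
  have "C_on m I S (pd i (\<lambda>p. f p * g p))" if "i \<in> I" for i
  proof (rule C_on_cong[OF assms(1,2)])
    have "C_on m I S f" "C_on m I S g" using Suc.prems C_on_Suc_imp by blast+
    then show "C_on m I S (\<lambda>p. pd i f p * g p + pd i g p * f p)"
      using Suc that by (intro C_on_add[OF assms(1,2)] Suc.IH) auto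
    show "pd i f p * g p + pd i g p * f p = pd i (\<lambda>p. f p * g p) p" if "p \<in> S" for p
      using DERIV_imp_deriv[OF d[OF \<open>i \<in> I\<close> that]] by (simp add: pd_def)
  qed
  with d show ?case using Suc.prems by (auto simp: real_differentiable_def intro!: continuous_map_real_mult)
qed (auto intro!: continuous_map_real_mult)

lemma C_on_const: "C_on m I S (\<lambda>_. c)"
proof (induction m arbitrary: c)
  case (Suc m)
  have "pd i (\<lambda>_. c) = (\<lambda>_. 0)" for i :: 'a by (auto simp: pd_def)
  then show ?case using Suc by simp
qed simp

lemma C_on_sum:
  assumes "finite I" "opn I S" "\<And>k. k \<in> K \<Longrightarrow> C_on m I S (f k)"
  shows "C_on m I S (\<lambda>p. \<Sum>k\<in>K. f k p)"
  using assms(3)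
  by (induction K rule: infinite_finite_induct) (auto simp: C_on_const intro!: C_on_add[OF assms(1,2)])

lemma C_on_coord:
  assumes "j \<in> I"
  shows "C_on m I S (\<lambda>p. p j)"
proof (cases m)
  case 0
  then show ?thesis using assms
    by (auto intro!: continuous_map_from_subtopology continuous_map_product_projection)
next
  case (Suc m')
  have d: "((\<lambda>t. (p(i := t)) j) has_real_derivative (if i = j then 1 else 0)) (at (p i))" for i and p :: "'a \<Rightarrow> real"
    by (auto intro!: derivative_eq_intros)
  have "pd i (\<lambda>p. p j) = (\<lambda>_. if i = j then 1 else 0)" for i
    using DERIV_imp_deriv[OF d] by (auto simp: pd_def)
  then show ?thesis using Suc assms d
    by (auto simp: C_on_const real_differentiable_def simp del: fun_upd_apply
        intro!: continuous_map_from_subtopology continuous_map_product_projection)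
qed

section \<open>The chain rule and composition of C^m functions\<close>

lemma mean_value_ball:
  fixes F :: "real \<Rightarrow> real"
  assumes F: "\<And>s. \<bar>s - a\<bar> < e \<Longrightarrow> (F has_real_derivative F' s) (at s)" and b: "\<bar>b - a\<bar> < e"
  shows "\<exists>z. \<bar>z - a\<bar> < e \<and> F b - F a = (b - a) * F' z"
proof (cases a b rule: linorder_cases)
  case less
  from MVT2[OF less, of F F'] F b obtain z where "a < z" "z < b" "F b - F a = (b - a) * F' z" by force
  then show ?thesis using b by (intro exI[of _ z]) auto
next
  case greater
  from MVT2[OF greater, of F F'] F b obtain z where "b < z" "z < a" "F a - F b = (a - b) * F' z" by force
  then show ?thesis using b by (intro exI[of _ z]) (auto simp: algebra_simps)
qed (use b in \<open>auto intro!: exI[of _ a]\<close>)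

text \<open>\<open>C_on\<close> gives differentiability along coordinate lines only, whereas c moves
  in all coordinates at once and is differentiable merely at t0. Continuity of the partial
  derivatives of l bridges this gap.\<close>

lemma chain_rule:
  fixes c :: "real \<Rightarrow> 'k \<Rightarrow> real"
  assumes K: "finite K" and B: "opn K B" and l: "C_on (Suc 0) K B l"
    and cB: "\<forall>\<^sub>F t in nhds t0. c t \<in> B"
    and c: "\<And>k. k \<in> K \<Longrightarrow> ((\<lambda>t. c t k) has_real_derivative d k) (at t0)"
  shows "((\<lambda>t. l (c t)) has_real_derivative (\<Sum>k\<in>K. pd k l (c t0) * d k)) (at t0)"
proof -
  have c0: "c t0 \<in> B" using cB by (rule eventually_nhds_x_imp_x)
  have ext: "q \<in> extensional K" if "q \<in> B" for q using opn_extensional[OF B that] .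
  \<comment> \<open>The coordinates are released one at a time; each step is the mean value theorem in one variable.\<close>
  define cJ where "cJ J t = (\<lambda>k. if k \<in> J then c t k else c t0 k)" for J t
  have step: "((\<lambda>t. l (cJ (insert k J) t) - l (cJ J t)) has_real_derivative pd k l (c t0) * d k) (at t0)"
    if J: "insert k J \<subseteq> K" "k \<notin> J" for k J
  proof -
    have k: "k \<in> K" using J by auto
    define g where "g t = l (cJ (insert k J) t) - l (cJ J t)" for t
    \<comment> \<open>The difference quotient in coordinate k, completed by its expected limit where
      \<open>c t k\<close> equals \<open>c t0 k\<close>. This can happen for t arbitrarily close to
      t0; the increment \<open>g t\<close> vanishes there as well, so that \<open>g t\<close> is
      always \<open>h t\<close> times the increment of the coordinate.\<close>
    define h where "h t = (if c t k = c t0 k then pd k l (c t0) else g t / (c t k - c t0 k))" for t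
    have g0: "g t0 = 0" by (simp add: g_def cJ_def cong: if_cong)
    have cJins: "cJ (insert k J) t = (cJ J t)(k := c t k)" for t by (auto simp: cJ_def)
    have cJk: "(cJ J t)(k := c t0 k) = cJ J t" for t using J by (auto simp: cJ_def)
    have gh: "g t = h t * (c t k - c t0 k)" for t
      by (auto simp: h_def) (metis cJins cJk diff_self g_def)
    have "(h \<longlongrightarrow> pd k l (c t0)) (at t0)"
    proof (rule tendstoI)
      fix \<epsilon> :: real assume "\<epsilon> > 0"
      have "continuous_map (subtopology (powertop_real K) B) euclideanreal (pd k l)"
        using l k by auto
      from continuous_map_box[OF K B c0 this \<open>\<epsilon> > 0\<close>]
      obtain e where e: "e > 0" "\<And>q. q \<in> extensional K \<Longrightarrow> (\<And>k. k \<in> K \<Longrightarrow> \<bar>q k - c t0 k\<bar> < e) \<Longrightarrow>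
          q \<in> B \<and> \<bar>pd k l q - pd k l (c t0)\<bar> < \<epsilon>" by blast
      have "\<forall>\<^sub>F t in at t0. \<forall>k\<in>K. \<bar>c t k - c t0 k\<bar> < e"
      proof (rule eventually_ball_finite[OF K], rule ballI)
        fix k assume "k \<in> K"
        from DERIV_isCont[OF c[OF this]] have "((\<lambda>t. c t k) \<longlongrightarrow> c t0 k) (at t0)"
          by (simp add: isCont_def)
        from tendstoD[OF this e(1)] show "\<forall>\<^sub>F t in at t0. \<bar>c t k - c t0 k\<bar> < e"
          by (simp add: dist_real_def)
      qed
      moreover have "\<forall>\<^sub>F t in at t0. c t \<in> B"
        using cB by (simp add: eventually_at_filter eventually_mono)
      ultimately show "\<forall>\<^sub>F t in at t0. dist (h t) (pd k l (c t0)) < \<epsilon>"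
      proof eventually_elim
        case (elim t)
        have q: "(cJ J t)(k := s) \<in> B \<and> \<bar>pd k l ((cJ J t)(k := s)) - pd k l (c t0)\<bar> < \<epsilon>"
          if "\<bar>s - c t0 k\<bar> < e" for s
        proof (rule e(2))
          have "c t \<in> extensional K" "c t0 \<in> extensional K" using elim c0 ext by auto
          then show "(cJ J t)(k := s) \<in> extensional K" using k by (auto simp: cJ_def extensional_def)
          show "\<bar>((cJ J t)(k := s)) m - c t0 m\<bar> < e" if "m \<in> K" for m
            using elim(1) that \<open>\<bar>s - c t0 k\<bar> < e\<close> e(1) by (auto simp: cJ_def)
        qed
        have "((\<lambda>s. l ((cJ J t)(k := s))) has_real_derivative pd k l ((cJ J t)(k := s))) (at s)"
          if "\<bar>s - c t0 k\<bar> < e" for s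
          using C_on_has_derivative[OF l conjunct1[OF q[OF that]] k] by simp
        moreover have "\<bar>c t k - c t0 k\<bar> < e" using elim(1) k by blast
        ultimately have "\<exists>z. \<bar>z - c t0 k\<bar> < e \<and> l ((cJ J t)(k := c t k)) - l ((cJ J t)(k := c t0 k))
            = (c t k - c t0 k) * pd k l ((cJ J t)(k := z))"
          by (rule mean_value_ball)
        then obtain z where z: "\<bar>z - c t0 k\<bar> < e" "g t = (c t k - c t0 k) * pd k l ((cJ J t)(k := z))"
          unfolding g_def cJins cJk by blast
        show ?case
        proof (cases "c t k = c t0 k")
          case False
          then have "h t = pd k l ((cJ J t)(k := z))" using z(2) by (simp add: h_def)
          then show ?thesis using q[OF z(1)] by (simp add: dist_real_def)
        qed (use \<open>\<epsilon> > 0\<close> in \<open>simp add: h_def\<close>)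
      qed
    qed
    moreover have "((\<lambda>t. (c t k - c t0 k) / (t - t0)) \<longlongrightarrow> d k) (at t0)"
      using c[OF k] by (simp add: has_field_derivative_iff)
    ultimately have "((\<lambda>t. h t * ((c t k - c t0 k) / (t - t0))) \<longlongrightarrow> pd k l (c t0) * d k) (at t0)"
      by (rule tendsto_mult)
    then show ?thesis unfolding g_def[symmetric] has_field_derivative_iff g0 using gh by simp
  qed
  have main: "((\<lambda>t. l (cJ J t)) has_real_derivative (\<Sum>k\<in>J. pd k l (c t0) * d k)) (at t0)"
    if "finite J" "J \<subseteq> K" for J
    using that
  proof (induction J)
    case empty
    then show ?case by (simp add: cJ_def)
  next
    case (insert k J)
    then show ?case using DERIV_add[OF insert.IH step[of k J]] by (simp add: add.commute)
  qed
  \<comment> \<open>Both functions take the default value outside K by extensionality, so releasing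
    the coordinates of K recovers the whole curve.\<close>
  have "cJ K t = c t" if "c t \<in> B" for t
    using ext[OF that] ext[OF c0] by (auto simp: cJ_def extensional_def)
  then have "\<forall>\<^sub>F t in nhds t0. l (cJ K t) = l (c t)" using cB by (auto elim!: eventually_mono)
  from DERIV_cong_ev[OF refl this refl] main[OF K subset_refl] show ?thesis by simp
qed

lemma pd_compose:
  assumes "finite I" "finite K" "opn I S" "opn K B" "\<And>p. p \<in> S \<Longrightarrow> u p \<in> B"
    "\<And>k. k \<in> K \<Longrightarrow> C_on (Suc 0) I S (\<lambda>p. u p k)" "C_on (Suc 0) K B l" "p \<in> S" "i \<in> I"
  shows "((\<lambda>t. l (u (p(i := t)))) has_real_derivative
      (\<Sum>k\<in>K. pd k l (u p) * pd i (\<lambda>p. u p k) p)) (at (p i))"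
    and "pd i (\<lambda>p. l (u p)) p = (\<Sum>k\<in>K. pd k l (u p) * pd i (\<lambda>p. u p k) p)"
proof -
  have "((\<lambda>t. l (u (p(i := t)))) has_real_derivative
      (\<Sum>k\<in>K. pd k l (u (p(i := p i))) * pd i (\<lambda>p. u p k) p)) (at (p i))"
  proof (rule chain_rule[OF assms(2,4,7)])
    show "\<forall>\<^sub>F t in nhds (p i). u (p(i := t)) \<in> B"
      using eventually_fun_upd_mem[OF assms(1,3,8,9)] by (rule eventually_mono) (rule assms(5))
  qed (rule C_on_has_derivative[OF assms(6,8,9)])
  then show *: "((\<lambda>t. l (u (p(i := t)))) has_real_derivative
      (\<Sum>k\<in>K. pd k l (u p) * pd i (\<lambda>p. u p k) p)) (at (p i))" by simp
  show "pd i (\<lambda>p. l (u p)) p = (\<Sum>k\<in>K. pd k l (u p) * pd i (\<lambda>p. u p k) p)"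
    using DERIV_imp_deriv[OF *] by (simp add: pd_def)
qed

lemma continuous_map_into_opn:
  assumes "opn K B" "\<And>p. p \<in> S \<Longrightarrow> u p \<in> B"
    "\<And>k. k \<in> K \<Longrightarrow> continuous_map (subtopology (powertop_real I) S) euclideanreal (\<lambda>p. u p k)"
  shows "continuous_map (subtopology (powertop_real I) S) (subtopology (powertop_real K) B) u"
  using assms opn_extensional[OF assms(1)]
  by (auto simp: continuous_map_in_subtopology continuous_map_componentwise)

text \<open>Induction on m for all l at once: by the chain rule a derivative is a sum of products of
  \<open>pd k l\<close> along u, covered by the induction hypothesis, and of partial derivatives of
  u, which have the required class by assumption.\<close>

lemma C_on_compose:
  assumes "finite I" "finite K" "opn I S" "opn K B" "\<And>p. p \<in> S \<Longrightarrow> u p \<in> B"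
    "\<And>k. k \<in> K \<Longrightarrow> C_on m I S (\<lambda>p. u p k)" "C_on m K B l"
  shows "C_on m I S (\<lambda>p. l (u p))"
  using assms(6,7)
proof (induction m arbitrary: l)
  case 0
  have "continuous_map (subtopology (powertop_real I) S) (subtopology (powertop_real K) B) u"
    using 0 assms by (intro continuous_map_into_opn) auto
  from continuous_map_compose[OF this, of euclideanreal l] 0(2) show ?case by (simp add: o_def)
next
  case (Suc m)
  have l1: "C_on (Suc 0) K B l" using Suc.prems(2) by (auto dest: C_on_continuous)
  have u1: "C_on (Suc 0) I S (\<lambda>p. u p k)" if "k \<in> K" for k
    using Suc.prems(1)[OF that] by (auto dest: C_on_continuous)
  have d: "((\<lambda>t. l (u (p(i := t)))) has_real_derivative
      (\<Sum>k\<in>K. pd k l (u p) * pd i (\<lambda>p. u p k) p)) (at (p i))"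
    "pd i (\<lambda>p. l (u p)) p = (\<Sum>k\<in>K. pd k l (u p) * pd i (\<lambda>p. u p k) p)"
    if "p \<in> S" "i \<in> I" for p i
    using pd_compose[of I K S B u l p i, OF assms(1-5) u1 l1 that] by blast+
  have u: "C_on m I S (\<lambda>p. u p k)" if "k \<in> K" for k
    using Suc.prems(1)[OF that] by (rule C_on_Suc_imp)
  have lu: "C_on m I S (\<lambda>p. l (u p))"
    by (rule Suc.IH[OF u C_on_Suc_imp[OF Suc.prems(2)]])
  have "C_on m I S (\<lambda>p. pd k l (u p))" if "k \<in> K" for k
    by (rule Suc.IH[OF u]) (use that Suc.prems(2) in auto)
  then have "C_on m I S (\<lambda>p. \<Sum>k\<in>K. pd k l (u p) * pd i (\<lambda>p. u p k) p)" if "i \<in> I" for i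
    using that Suc.prems(1) by (intro C_on_sum C_on_mult assms(1,3)) auto
  then have "C_on m I S (pd i (\<lambda>p. l (u p)))" if "i \<in> I" for i
    by (rule C_on_cong[OF assms(1,3), rotated]) (use that d(2) in auto)
  then show ?case using d(1) C_on_continuous[OF lu] by (auto simp: real_differentiable_def)
qed

section \<open>Smooth functions and agreement of their derivatives up to a given order\<close>

lemma smooth_cong:
  "finite I \<Longrightarrow> opn I S \<Longrightarrow> (\<And>p. p \<in> S \<Longrightarrow> f p = g p) \<Longrightarrow> smooth_real_on I S f \<Longrightarrow> smooth_real_on I S g"
  unfolding smooth_real_on_def using C_on_cong by blast

lemma smooth_subset: "smooth_real_on I S f \<Longrightarrow> T \<subseteq> S \<Longrightarrow> smooth_real_on I T f"
  unfolding smooth_real_on_def using C_on_subset by blast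

lemma smooth_local:
  assumes "\<And>p. p \<in> S \<Longrightarrow> \<exists>T. opn I T \<and> p \<in> T \<and> smooth_real_on I (S \<inter> T) f"
  shows "smooth_real_on I S f"
  unfolding smooth_real_on_def
proof
  show "C_on m I S f" for m
    by (rule C_on_local) (use assms in \<open>unfold smooth_real_on_def, blast\<close>)
qed

lemma smooth_pd: "smooth_real_on I S f \<Longrightarrow> i \<in> I \<Longrightarrow> smooth_real_on I S (pd i f)"
  unfolding smooth_real_on_def by (meson C_on.simps(2))

lemma smooth_iter_pd: "smooth_real_on I S f \<Longrightarrow> set is \<subseteq> I \<Longrightarrow> smooth_real_on I S (iter_pd is f)"
  by (induction "is") (auto simp: smooth_pd)

lemma smooth_coord: "j \<in> I \<Longrightarrow> smooth_real_on I S (\<lambda>p. p j)"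
  by (simp add: smooth_real_on_def C_on_coord)

lemma smooth_compose:
  assumes "finite I" "finite K" "opn I S" "opn K B" "\<And>p. p \<in> S \<Longrightarrow> u p \<in> B"
    "\<And>k. k \<in> K \<Longrightarrow> smooth_real_on I S (\<lambda>p. u p k)" "smooth_real_on K B l"
  shows "smooth_real_on I S (\<lambda>p. l (u p))"
  using assms(6,7) C_on_compose[of I K S B u, OF assms(1-5)] unfolding smooth_real_on_def by blast

lemma smooth_mult:
  "finite I \<Longrightarrow> opn I S \<Longrightarrow> smooth_real_on I S f \<Longrightarrow> smooth_real_on I S g \<Longrightarrow> smooth_real_on I S (\<lambda>p. f p * g p)"
  unfolding smooth_real_on_def using C_on_mult by blast

lemma smooth_continuous:
  "smooth_real_on I S f \<Longrightarrow> continuous_map (subtopology (powertop_real I) S) euclideanreal f"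
  unfolding smooth_real_on_def using C_on_continuous by blast

text \<open>Equality of r-jets at p of real functions in coordinates. All index lists are compared,
  as in \<open>same_jet\<close>; the nondecreasing lists of \<open>jet_idx\<close> are among
  them.\<close>

definition partials_agree :: "nat \<Rightarrow> 'i set \<Rightarrow> ('i \<Rightarrow> real) \<Rightarrow> (('i \<Rightarrow> real) \<Rightarrow> real) \<Rightarrow> (('i \<Rightarrow> real) \<Rightarrow> real) \<Rightarrow> bool" where
  "partials_agree r I p f g \<longleftrightarrow> (\<forall>is. set is \<subseteq> I \<and> length is \<le> r \<longrightarrow> iter_pd is f p = iter_pd is g p)"

lemma partials_agree_refl: "partials_agree r I p f f"
  by (simp add: partials_agree_def)

lemma partials_agree_trans: "partials_agree r I p f g \<Longrightarrow> partials_agree r I p g h \<Longrightarrow> partials_agree r I p f h"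
  by (simp add: partials_agree_def)

lemma partials_agree_sym: "partials_agree r I p f g \<Longrightarrow> partials_agree r I p g f"
  by (simp add: partials_agree_def)

lemma partials_agree_mono: "partials_agree r I p f g \<Longrightarrow> s \<le> r \<Longrightarrow> partials_agree s I p f g"
  by (simp add: partials_agree_def)

lemma partials_agree_value: "partials_agree r I p f g \<Longrightarrow> f p = g p"
  unfolding partials_agree_def by (drule spec[of _ "[]"]) simp

lemma partials_agree_cong:
  assumes "finite I" "opn I S" "p \<in> S" "\<And>q. q \<in> S \<Longrightarrow> f q = g q"
  shows "partials_agree r I p f g"
  unfolding partials_agree_def using iter_pd_cong[of I S f g, OF assms(1,2,4)] assms(3) by blast

text \<open>The bookkeeping behind the order k + r: the indices js, at most k of them, are
  differentiated first, and r orders remain. Further indices only prolong the list at its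
  front.\<close>

lemma partials_agree_iter_pd:
  assumes "partials_agree (k + r) I p f g" "set js \<subseteq> I" "length js \<le> k"
  shows "partials_agree r I p (iter_pd js f) (iter_pd js g)"
  using assms unfolding partials_agree_def iter_pd_append[symmetric] by auto

text \<open>The derivative split off is the innermost one, that is the last list element, although
  \<open>iter_pd\<close> recurses on the first. The inductions below need this form: they apply a
  differentiation rule to the function itself before the remaining derivatives are taken.\<close>

lemma partials_agree_Suc: "partials_agree (Suc r) I p f g \<longleftrightarrow> f p = g p \<and> (\<forall>i\<in>I. partials_agree r I p (pd i f) (pd i g))"
proof
  assume L: "partials_agree (Suc r) I p f g"
  have "partials_agree r I p (pd i f) (pd i g)" if "i \<in> I" for i
    using partials_agree_iter_pd[of 1 r I p f g "[i]"] L that by simp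
  then show "f p = g p \<and> (\<forall>i\<in>I. partials_agree r I p (pd i f) (pd i g))" using partials_agree_value[OF L] by blast
next
  assume R: "f p = g p \<and> (\<forall>i\<in>I. partials_agree r I p (pd i f) (pd i g))"
  show "partials_agree (Suc r) I p f g" unfolding partials_agree_def
  proof (intro allI impI)
    fix "is" assume "set is \<subseteq> I \<and> length is \<le> Suc r"
    then show "iter_pd is f p = iter_pd is g p"
    proof (cases "is" rule: rev_cases)
      case (snoc js i)
      then show ?thesis using R \<open>set is \<subseteq> I \<and> length is \<le> Suc r\<close>
        by (auto simp: iter_pd_append partials_agree_def)
    qed (use R in auto)
  qed
qed

lemma pd_add:
  assumes "smooth_real_on I S f" "smooth_real_on I S g" "p \<in> S" "i \<in> I"
  shows "pd i (\<lambda>p. f p + g p) p = pd i f p + pd i g p"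
  using DERIV_add[OF C_on_has_derivative[of 0 I S f p i] C_on_has_derivative[of 0 I S g p i]] assms
  unfolding smooth_real_on_def pd_def[of i "\<lambda>p. f p + g p"] by (intro DERIV_imp_deriv) auto

lemma pd_mult:
  assumes "smooth_real_on I S f" "smooth_real_on I S g" "p \<in> S" "i \<in> I"
  shows "pd i (\<lambda>p. f p * g p) p = pd i f p * g p + pd i g p * f p"
  using DERIV_mult[OF C_on_has_derivative[of 0 I S f p i] C_on_has_derivative[of 0 I S g p i]] assms
  unfolding smooth_real_on_def pd_def[of i "\<lambda>p. f p * g p"] by (intro DERIV_imp_deriv) auto

lemma partials_agree_add:
  assumes "finite I" "opn I S" "p \<in> S"
    "smooth_real_on I S f" "smooth_real_on I S f'" "smooth_real_on I S g" "smooth_real_on I S g'"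
    "partials_agree r I p f f'" "partials_agree r I p g g'"
  shows "partials_agree r I p (\<lambda>p. f p + g p) (\<lambda>p. f' p + g' p)"
  using assms(4-)
proof (induction r arbitrary: f f' g g')
  case 0
  then show ?case by (auto simp: partials_agree_def)
next
  case (Suc r)
  have "partials_agree r I p (pd i (\<lambda>p. f p + g p)) (pd i (\<lambda>p. f' p + g' p))" if i: "i \<in> I" for i
  proof -
    have "partials_agree r I p (\<lambda>p. pd i f p + pd i g p) (\<lambda>p. pd i f' p + pd i g' p)"
      using Suc.prems i by (intro Suc.IH smooth_pd) (auto simp: partials_agree_Suc)
    moreover have "partials_agree r I p (pd i (\<lambda>p. f p + g p)) (\<lambda>p. pd i f p + pd i g p)"
      by (rule partials_agree_cong[OF assms(1-3)]) (rule pd_add[OF Suc.prems(1,3) _ i])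
    moreover have "partials_agree r I p (\<lambda>p. pd i f' p + pd i g' p) (pd i (\<lambda>p. f' p + g' p))"
      by (rule partials_agree_cong[OF assms(1-3)]) (rule pd_add[OF Suc.prems(2,4) _ i, symmetric])
    ultimately show ?thesis using partials_agree_trans by blast
  qed
  then show ?case using Suc.prems by (simp add: partials_agree_Suc)
qed

lemma smooth_sum:
  "finite I \<Longrightarrow> opn I S \<Longrightarrow> (\<And>k. k \<in> K \<Longrightarrow> smooth_real_on I S (f k)) \<Longrightarrow> smooth_real_on I S (\<lambda>p. \<Sum>k\<in>K. f k p)"
  unfolding smooth_real_on_def by (intro allI C_on_sum) auto

lemma partials_agree_mult:
  assumes "finite I" "opn I S" "p \<in> S"
    "smooth_real_on I S f" "smooth_real_on I S f'" "smooth_real_on I S g" "smooth_real_on I S g'"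
    "partials_agree r I p f f'" "partials_agree r I p g g'"
  shows "partials_agree r I p (\<lambda>p. f p * g p) (\<lambda>p. f' p * g' p)"
  using assms(4-)
proof (induction r arbitrary: f f' g g')
  case 0
  then show ?case by (auto simp: partials_agree_def)
next
  case (Suc r)
  have "partials_agree r I p (pd i (\<lambda>p. f p * g p)) (pd i (\<lambda>p. f' p * g' p))" if i: "i \<in> I" for i
  proof -
    \<comment> \<open>The product rule also contains the undifferentiated factors; for them the
      order is lowered from \<open>Suc r\<close> to r.\<close>
    have "partials_agree r I p f f'" "partials_agree r I p g g'" using Suc.prems partials_agree_mono le_SucI by blast+
    then have "partials_agree r I p (\<lambda>p. pd i f p * g p + pd i g p * f p) (\<lambda>p. pd i f' p * g' p + pd i g' p * f' p)"
      using Suc.prems i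
      by (intro partials_agree_add[OF assms(1-3)] smooth_mult assms(1,2) Suc.IH smooth_pd) (auto simp: partials_agree_Suc)
    moreover have "partials_agree r I p (pd i (\<lambda>p. f p * g p)) (\<lambda>p. pd i f p * g p + pd i g p * f p)"
      by (rule partials_agree_cong[OF assms(1-3)]) (rule pd_mult[OF Suc.prems(1,3) _ i])
    moreover have "partials_agree r I p (\<lambda>p. pd i f' p * g' p + pd i g' p * f' p) (pd i (\<lambda>p. f' p * g' p))"
      by (rule partials_agree_cong[OF assms(1-3)]) (rule pd_mult[OF Suc.prems(2,4) _ i, symmetric])
    ultimately show ?thesis using partials_agree_trans by blast
  qed
  then show ?case using Suc.prems by (simp add: partials_agree_Suc)
qed

lemma partials_agree_sum:
  assumes "finite I" "opn I S" "p \<in> S"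
    "\<And>k. k \<in> K \<Longrightarrow> smooth_real_on I S (f k)" "\<And>k. k \<in> K \<Longrightarrow> smooth_real_on I S (f' k)"
    "\<And>k. k \<in> K \<Longrightarrow> partials_agree r I p (f k) (f' k)"
  shows "partials_agree r I p (\<lambda>p. \<Sum>k\<in>K. f k p) (\<lambda>p. \<Sum>k\<in>K. f' k p)"
  using assms(4-)
  by (induction K rule: infinite_finite_induct)
    (auto simp: partials_agree_refl intro!: partials_agree_add[OF assms(1-3)] smooth_sum assms(1,2))

lemma smooth_C1: "smooth_real_on I S f \<Longrightarrow> C_on (Suc 0) I S f"
  unfolding smooth_real_on_def by blast

text \<open>Induction on r with l and l' varying and u and u' fixed. One chain rule replaces the
  outer functions by their partial derivatives, which agree to one order less, and multiplies them
  by partial derivatives of the inner ones, which do so too. In this way no explicit formula for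
  higher derivatives of composites arises.\<close>

lemma partials_agree_compose:
  assumes "finite I" "finite K" "opn I S" "opn K B" "p \<in> S"
    "\<And>p. p \<in> S \<Longrightarrow> u p \<in> B" "\<And>p. p \<in> S \<Longrightarrow> u' p \<in> B" "u p = u' p"
    "\<And>k. k \<in> K \<Longrightarrow> smooth_real_on I S (\<lambda>p. u p k)" "\<And>k. k \<in> K \<Longrightarrow> smooth_real_on I S (\<lambda>p. u' p k)"
    "\<And>k. k \<in> K \<Longrightarrow> partials_agree r I p (\<lambda>p. u p k) (\<lambda>p. u' p k)"
    "smooth_real_on K B l" "smooth_real_on K B l'" "partials_agree r K (u p) l l'"
  shows "partials_agree r I p (\<lambda>p. l (u p)) (\<lambda>p. l' (u' p))"
  using assms(11-)
proof (induction r arbitrary: l l')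
  case 0
  then show ?case using assms(8) by (auto simp: partials_agree_def)
next
  case (Suc r)
  have *: "partials_agree r I p (\<lambda>p. u p k) (\<lambda>p. u' p k)" if "k \<in> K" for k
    using Suc.prems(1)[OF that] by (rule partials_agree_mono) simp
  have sm: "smooth_real_on I S (\<lambda>p. pd k l (u p))" "smooth_real_on I S (\<lambda>p. pd k l' (u' p))" if "k \<in> K" for k
    using smooth_compose[of I K S B u "pd k l", OF assms(1-4,6,9)] Suc.prems(2)
      smooth_compose[of I K S B u' "pd k l'", OF assms(1-4,7,10)] Suc.prems(3) that
    by (simp_all add: smooth_pd)
  have "partials_agree r I p (pd i (\<lambda>p. l (u p))) (pd i (\<lambda>p. l' (u' p)))" if i: "i \<in> I" for i
  proof -
    have lk: "partials_agree r K (u p) (pd k l) (pd k l')" and uk: "partials_agree r I p (pd i (\<lambda>p. u p k)) (pd i (\<lambda>p. u' p k))"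
      if "k \<in> K" for k
      using Suc.prems that i by (auto simp: partials_agree_Suc)
    have luk: "partials_agree r I p (\<lambda>p. pd k l (u p)) (\<lambda>p. pd k l' (u' p))" if "k \<in> K" for k
      using Suc.IH[OF * smooth_pd[OF Suc.prems(2) that] smooth_pd[OF Suc.prems(3) that] lk[OF that]] .
    have "partials_agree r I p (\<lambda>p. \<Sum>k\<in>K. pd k l (u p) * pd i (\<lambda>p. u p k) p)
        (\<lambda>p. \<Sum>k\<in>K. pd k l' (u' p) * pd i (\<lambda>p. u' p k) p)"
    proof (rule partials_agree_sum[OF assms(1,3,5)])
      fix k assume k: "k \<in> K"
      note s = sm[OF k] smooth_pd[OF assms(9)[OF k] i] smooth_pd[OF assms(10)[OF k] i]
      show "smooth_real_on I S (\<lambda>p. pd k l (u p) * pd i (\<lambda>p. u p k) p)"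
        by (rule smooth_mult[OF assms(1,3) s(1,3)])
      show "smooth_real_on I S (\<lambda>p. pd k l' (u' p) * pd i (\<lambda>p. u' p k) p)"
        by (rule smooth_mult[OF assms(1,3) s(2,4)])
      show "partials_agree r I p (\<lambda>p. pd k l (u p) * pd i (\<lambda>p. u p k) p) (\<lambda>p. pd k l' (u' p) * pd i (\<lambda>p. u' p k) p)"
        by (rule partials_agree_mult[OF assms(1,3,5) s luk[OF k] uk[OF k]])
    qed
    moreover have "partials_agree r I p (pd i (\<lambda>p. l (u p))) (\<lambda>p. \<Sum>k\<in>K. pd k l (u p) * pd i (\<lambda>p. u p k) p)"
      by (rule partials_agree_cong[OF assms(1,3,5)])
        (rule pd_compose(2)[of I K S B u l, OF assms(1-4,6) smooth_C1[OF assms(9)] smooth_C1[OF Suc.prems(2)] _ i])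
    moreover have "partials_agree r I p (\<lambda>p. \<Sum>k\<in>K. pd k l' (u' p) * pd i (\<lambda>p. u' p k) p) (pd i (\<lambda>p. l' (u' p)))"
      by (rule partials_agree_cong[OF assms(1,3,5)])
        (rule pd_compose(2)[of I K S B u' l', OF assms(1-4,7) smooth_C1[OF assms(10)] smooth_C1[OF Suc.prems(3)] _ i, symmetric])
    ultimately show ?thesis using partials_agree_trans by blast
  qed
  moreover have "l (u p) = l' (u' p)" using partials_agree_value[OF Suc.prems(4)] assms(8) by simp
  ultimately show ?case by (simp add: partials_agree_Suc)
qed

section \<open>Smooth maps between manifolds and their jets\<close>

lemma chartD:
  assumes "smooth_manifold M" "(U, a) \<in> atlas M"
  shows "openin (mtop M) U" "U \<subseteq> pts M" "inj_on a U" "opn (idx M) (a ` U)"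
    "homeomorphic_map (subtopology (mtop M) U) (subtopology (powertop_real (idx M)) (a ` U)) a"
proof -
  show U: "openin (mtop M) U" "opn (idx M) (a ` U)"
    and h: "homeomorphic_map (subtopology (mtop M) U) (subtopology (powertop_real (idx M)) (a ` U)) a"
    using assms unfolding smooth_manifold_def by blast+
  show "U \<subseteq> pts M" by (rule openin_subset[OF U(1)])
  then have "topspace (subtopology (mtop M) U) = U" by auto
  then show "inj_on a U" using homeomorphic_imp_injective_map[OF h] by metis
qed

lemma finite_idx: "smooth_manifold M \<Longrightarrow> finite (idx M)"
  by (simp add: smooth_manifold_def)

lemma chart_at:
  assumes "smooth_manifold M" "x \<in> pts M"
  obtains U a where "(U, a) \<in> atlas M" "x \<in> U"
  using assms unfolding smooth_manifold_def by fast

lemma chart_inv: "smooth_manifold M \<Longrightarrow> (U, a) \<in> atlas M \<Longrightarrow> z \<in> U \<Longrightarrow> inv_into U a (a z) = z"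
  by (simp add: chartD(3) inv_into_f_f)

lemma chart_open:
  assumes "smooth_manifold M" "(U, a) \<in> atlas M" "openin (mtop M) W"
  shows "opn (idx M) (a ` (U \<inter> W))"
proof -
  have "openin (subtopology (mtop M) U) (U \<inter> W)"
    using assms(3) by (rule openin_subtopology_Int2)
  then have "openin (subtopology (powertop_real (idx M)) (a ` U)) (a ` (U \<inter> W))"
    using homeomorphic_imp_open_map[OF chartD(5)[OF assms(1,2)]] by (simp add: open_map_def)
  then show ?thesis using chartD(4)[OF assms(1,2)] by (rule openin_trans_full)
qed

text \<open>The common core of \<open>smooth_map_on\<close>, applied to components in target charts,
  and of \<open>smooth_near\<close>, applied to test functions. It mentions charts of the source
  only.\<close>

definition smooth_fun_on :: "('a, 'i) manifold \<Rightarrow> 'a set \<Rightarrow> ('a \<Rightarrow> real) \<Rightarrow> bool" where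
  "smooth_fun_on M W f \<longleftrightarrow>
     (\<forall>(U, a)\<in>atlas M. smooth_real_on (idx M) (a ` (U \<inter> W)) (\<lambda>p. f (inv_into U a p)))"

lemma smooth_fun_onD:
  "smooth_fun_on M W f \<Longrightarrow> (U, a) \<in> atlas M \<Longrightarrow> smooth_real_on (idx M) (a ` (U \<inter> W)) (\<lambda>p. f (inv_into U a p))"
  unfolding smooth_fun_on_def by fast

lemma smooth_fun_onI:
  "(\<And>U a. (U, a) \<in> atlas M \<Longrightarrow> smooth_real_on (idx M) (a ` (U \<inter> W)) (\<lambda>p. f (inv_into U a p))) \<Longrightarrow> smooth_fun_on M W f"
  unfolding smooth_fun_on_def by fast

lemma smooth_fun_on_subset: "smooth_fun_on M W f \<Longrightarrow> W' \<subseteq> W \<Longrightarrow> smooth_fun_on M W' f"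
  by (rule smooth_fun_onI) (erule (1) smooth_subset[OF smooth_fun_onD], blast)

lemma smooth_fun_on_cong:
  assumes "smooth_manifold M" "openin (mtop M) W" "\<And>z. z \<in> W \<Longrightarrow> f z = g z" "smooth_fun_on M W f"
  shows "smooth_fun_on M W g"
proof (rule smooth_fun_onI)
  fix U a assume c: "(U, a) \<in> atlas M"
  show "smooth_real_on (idx M) (a ` (U \<inter> W)) (\<lambda>p. g (inv_into U a p))"
  proof (rule smooth_cong[OF finite_idx chart_open _ smooth_fun_onD])
    show "f (inv_into U a p) = g (inv_into U a p)" if "p \<in> a ` (U \<inter> W)" for p
      using that chart_inv[OF assms(1) c] assms(3) by auto
  qed (use assms c in auto)
qed

lemma smooth_fun_on_local:
  assumes M: "smooth_manifold M"
    and loc: "\<And>z. z \<in> W \<Longrightarrow> \<exists>W'. openin (mtop M) W' \<and> z \<in> W' \<and> smooth_fun_on M (W \<inter> W') f"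
  shows "smooth_fun_on M W f"
proof (rule smooth_fun_onI)
  fix U a assume c: "(U, a) \<in> atlas M"
  show "smooth_real_on (idx M) (a ` (U \<inter> W)) (\<lambda>p. f (inv_into U a p))"
  proof (rule smooth_local)
    fix p assume "p \<in> a ` (U \<inter> W)"
    then obtain z where z: "z \<in> U" "z \<in> W" "p = a z" by auto
    with loc obtain W' where W': "openin (mtop M) W'" "z \<in> W'" "smooth_fun_on M (W \<inter> W') f" by blast
    \<comment> \<open>By injectivity of the chart an intersection of images lies in the image of the
      intersection.\<close>
    have "a ` (U \<inter> W) \<inter> a ` (U \<inter> W') \<subseteq> a ` (U \<inter> (W \<inter> W'))"
      using chartD(3)[OF M c] by (auto simp: inj_on_def)
    with smooth_fun_onD[OF W'(3) c]
    have "smooth_real_on (idx M) (a ` (U \<inter> W) \<inter> a ` (U \<inter> W')) (\<lambda>p. f (inv_into U a p))"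
      by (rule smooth_subset)
    then show "\<exists>T. opn (idx M) T \<and> p \<in> T \<and> smooth_real_on (idx M) (a ` (U \<inter> W) \<inter> T) (\<lambda>p. f (inv_into U a p))"
      using chart_open[OF M c W'(1)] z W'(2) by blast
  qed
qed

lemma smooth_near_iff: "f \<in> smooth_near M x \<longleftrightarrow> (\<exists>W. openin (mtop M) W \<and> x \<in> W \<and> smooth_fun_on M W f)"
  unfolding smooth_near_def smooth_fun_on_def by simp

lemma smooth_map_on_iff:
  "smooth_map_on M N W f \<longleftrightarrow>
     openin (mtop M) W \<and> continuous_map (subtopology (mtop M) W) (mtop N) f \<and>
     (\<forall>(V, b)\<in>atlas N. \<forall>j\<in>idx N. smooth_fun_on M {z \<in> W. f z \<in> V} (\<lambda>z. b (f z) j))"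
proof -
  have "U \<inter> {z \<in> W. f z \<in> V} = {z \<in> U \<inter> W. f z \<in> V}" for U V by auto
  then show ?thesis unfolding smooth_map_on_def smooth_fun_on_def by fastforce
qed

lemma smooth_map_onD:
  assumes "smooth_map_on M N W f"
  shows "openin (mtop M) W" "continuous_map (subtopology (mtop M) W) (mtop N) f"
    "W \<subseteq> pts M" "z \<in> W \<Longrightarrow> f z \<in> pts N"
    "(V, b) \<in> atlas N \<Longrightarrow> j \<in> idx N \<Longrightarrow> smooth_fun_on M {z \<in> W. f z \<in> V} (\<lambda>z. b (f z) j)"
proof -
  show o: "openin (mtop M) W" and c: "continuous_map (subtopology (mtop M) W) (mtop N) f"
    using assms by (auto simp: smooth_map_on_def)
  show s: "W \<subseteq> pts M" by (rule openin_subset[OF o])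
  show "z \<in> W \<Longrightarrow> f z \<in> pts N"
    using continuous_map_image_subset_topspace[OF c] s by auto
  show "(V, b) \<in> atlas N \<Longrightarrow> j \<in> idx N \<Longrightarrow> smooth_fun_on M {z \<in> W. f z \<in> V} (\<lambda>z. b (f z) j)"
    using assms unfolding smooth_map_on_iff by fast
qed

lemma open_preimage:
  assumes "smooth_map_on M N W f" "openin (mtop N) V"
  shows "openin (mtop M) {z \<in> W. f z \<in> V}"
proof -
  note D = smooth_map_onD[OF assms(1)]
  have "{z \<in> topspace (subtopology (mtop M) W). f z \<in> V} = {z \<in> W. f z \<in> V}"
    using D(3) by auto
  then show ?thesis
    using openin_continuous_map_preimage[OF D(2) assms(2)] D(1) by (metis openin_trans_full)
qed

lemma smooth_map_on_subset:
  assumes "smooth_map_on M N W f" "W' \<subseteq> W" "openin (mtop M) W'"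
  shows "smooth_map_on M N W' f"
  unfolding smooth_map_on_iff
proof (intro conjI)
  note D = smooth_map_onD[OF assms(1)]
  show "continuous_map (subtopology (mtop M) W') (mtop N) f"
    using D(2) assms(2) by (rule continuous_map_from_subtopology_mono)
  show "\<forall>(V, b)\<in>atlas N. \<forall>j\<in>idx N. smooth_fun_on M {z \<in> W'. f z \<in> V} (\<lambda>z. b (f z) j)"
  proof clarify
    fix V b j assume c: "(V, b) \<in> atlas N" "j \<in> idx N"
    show "smooth_fun_on M {z \<in> W'. f z \<in> V} (\<lambda>z. b (f z) j)"
      by (rule smooth_fun_on_subset[OF D(5)[OF c]]) (use assms(2) in auto)
  qed
qed (rule assms(3))

lemma smooth_map_on_cong:
  assumes "smooth_manifold M" "smooth_manifold N" "smooth_map_on M N W f" "\<And>z. z \<in> W \<Longrightarrow> f z = g z"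
  shows "smooth_map_on M N W g"
  unfolding smooth_map_on_iff
proof (intro conjI)
  note D = smooth_map_onD[OF assms(3)]
  show "openin (mtop M) W" by (rule D(1))
  show "continuous_map (subtopology (mtop M) W) (mtop N) g"
    by (rule continuous_map_eq[OF D(2)]) (use assms(4) in auto)
  show "\<forall>(V, b)\<in>atlas N. \<forall>j\<in>idx N. smooth_fun_on M {z \<in> W. g z \<in> V} (\<lambda>z. b (g z) j)"
  proof clarify
    fix V b j assume c: "(V, b) \<in> atlas N" and j: "j \<in> idx N"
    have eq: "{z \<in> W. g z \<in> V} = {z \<in> W. f z \<in> V}" using assms(4) by auto
    show "smooth_fun_on M {z \<in> W. g z \<in> V} (\<lambda>z. b (g z) j)"
      unfolding eq
      by (rule smooth_fun_on_cong[OF assms(1) open_preimage[OF assms(3) chartD(1)[OF assms(2) c]] _ D(5)[OF c j]])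
        (use assms(4) in auto)
  qed
qed

text \<open>Smoothness is local, so near z a chart b of N around f z can be inserted: g o f becomes
  (g o b^-1) o (b o f), a composite of functions between coordinate spaces.\<close>

lemma smooth_fun_on_compose:
  assumes M: "smooth_manifold M" and N: "smooth_manifold N"
    and f: "smooth_map_on M N W f" and g: "smooth_fun_on N W' g" and W': "openin (mtop N) W'"
    and fW: "\<And>z. z \<in> W \<Longrightarrow> f z \<in> W'"
  shows "smooth_fun_on M W (\<lambda>z. g (f z))"
proof (rule smooth_fun_onI)
  fix U a assume c: "(U, a) \<in> atlas M"
  show "smooth_real_on (idx M) (a ` (U \<inter> W)) (\<lambda>p. g (f (inv_into U a p)))"
  proof (rule smooth_local)
    fix p assume "p \<in> a ` (U \<inter> W)"
    then obtain z where z: "z \<in> U" "z \<in> W" "p = a z" by auto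
    obtain V b where V: "(V, b) \<in> atlas N" "f z \<in> V"
      using chart_at[OF N smooth_map_onD(4)[OF f z(2)]] .
    let ?T = "a ` (U \<inter> {z \<in> W. f z \<in> V})"
    have T: "opn (idx M) ?T"
      by (rule chart_open[OF M c open_preimage[OF f chartD(1)[OF N V(1)]]])
    have u: "smooth_real_on (idx M) ?T (\<lambda>p. b (f (inv_into U a p)) j)" if "j \<in> idx N" for j
      by (rule smooth_fun_onD[OF smooth_map_onD(5)[OF f V(1) that] c])
    have uB: "b (f (inv_into U a p)) \<in> b ` (V \<inter> W')" if "p \<in> ?T" for p
      using that chart_inv[OF M c] fW by auto
    have "smooth_real_on (idx M) ?T (\<lambda>p. g (inv_into V b (b (f (inv_into U a p)))))"
      by (rule smooth_compose[of _ _ _ _ "\<lambda>p. b (f (inv_into U a p))" "\<lambda>q. g (inv_into V b q)",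
            OF finite_idx[OF M] finite_idx[OF N] T chart_open[OF N V(1) W'] uB u smooth_fun_onD[OF g V(1)]])
    then have "smooth_real_on (idx M) ?T (\<lambda>p. g (f (inv_into U a p)))"
    proof (rule smooth_cong[OF finite_idx[OF M] T, rotated])
      show "g (inv_into V b (b (f (inv_into U a p)))) = g (f (inv_into U a p))" if "p \<in> ?T" for p
        using that chart_inv[OF M c] chart_inv[OF N V(1)] by auto
    qed
    then have "smooth_real_on (idx M) (a ` (U \<inter> W) \<inter> ?T) (\<lambda>p. g (f (inv_into U a p)))"
      by (rule smooth_subset) blast
    then show "\<exists>T. opn (idx M) T \<and> p \<in> T \<and>
        smooth_real_on (idx M) (a ` (U \<inter> W) \<inter> T) (\<lambda>p. g (f (inv_into U a p)))"
      using T z V(2) by blast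
  qed
qed

lemma smooth_map_on_compose:
  assumes M: "smooth_manifold M" and N: "smooth_manifold N" and P: "smooth_manifold P"
    and f: "smooth_map_on M N W f" and g: "smooth_map_on N P W' g"
    and fW: "\<And>z. z \<in> W \<Longrightarrow> f z \<in> W'"
  shows "smooth_map_on M P W (\<lambda>z. g (f z))"
  unfolding smooth_map_on_iff
proof (intro conjI)
  note F = smooth_map_onD[OF f] and G = smooth_map_onD[OF g]
  show "openin (mtop M) W" by (rule F(1))
  have "continuous_map (subtopology (mtop M) W) (subtopology (mtop N) W') f"
    using F(2) fW F(3) by (auto simp: continuous_map_in_subtopology)
  from continuous_map_compose[OF this G(2)]
  show "continuous_map (subtopology (mtop M) W) (mtop P) (\<lambda>z. g (f z))" by (simp add: o_def)
  show "\<forall>(V, b)\<in>atlas P. \<forall>j\<in>idx P. smooth_fun_on M {z \<in> W. g (f z) \<in> V} (\<lambda>z. b (g (f z)) j)"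
  proof clarify
    fix V b j assume c: "(V, b) \<in> atlas P" and j: "j \<in> idx P"
    have V': "openin (mtop N) {w \<in> W'. g w \<in> V}"
      by (rule open_preimage[OF g chartD(1)[OF P c]])
    have *: "{z \<in> W. g (f z) \<in> V} = {z \<in> W. f z \<in> {w \<in> W'. g w \<in> V}}" using fW by auto
    have "openin (mtop M) {z \<in> W. g (f z) \<in> V}"
      unfolding * by (rule open_preimage[OF f V'])
    then have "smooth_map_on M N {z \<in> W. g (f z) \<in> V} f"
      by (rule smooth_map_on_subset[OF f, rotated]) auto
    then show "smooth_fun_on M {z \<in> W. g (f z) \<in> V} (\<lambda>z. b (g (f z)) j)"
      by (rule smooth_fun_on_compose[OF M N _ G(5)[OF c j] V']) (use fW in auto)
  qed
qed

section \<open>Jets of maps and their composition\<close>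

lemma same_jet_iff:
  "same_jet r M N f g x \<longleftrightarrow> f x = g x \<and>
     (\<forall>(U, a)\<in>atlas M. \<forall>(V, b)\<in>atlas N. x \<in> U \<and> f x \<in> V \<longrightarrow>
        (\<forall>j\<in>idx N. partials_agree r (idx M) (a x) (\<lambda>p. b (f (inv_into U a p)) j) (\<lambda>p. b (g (inv_into U a p)) j)))"
  unfolding same_jet_def partials_agree_def by (rule conj_cong[OF refl]) fast

lemma same_jetD:
  assumes "same_jet r M N f g x"
  shows "f x = g x"
    "(U, a) \<in> atlas M \<Longrightarrow> (V, b) \<in> atlas N \<Longrightarrow> x \<in> U \<Longrightarrow> f x \<in> V \<Longrightarrow> j \<in> idx N \<Longrightarrow>
      partials_agree r (idx M) (a x) (\<lambda>p. b (f (inv_into U a p)) j) (\<lambda>p. b (g (inv_into U a p)) j)"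
  using assms unfolding same_jet_iff by fast+

lemma same_jetI:
  assumes "f x = g x"
    "\<And>U a V b j. (U, a) \<in> atlas M \<Longrightarrow> (V, b) \<in> atlas N \<Longrightarrow> x \<in> U \<Longrightarrow> f x \<in> V \<Longrightarrow> j \<in> idx N \<Longrightarrow>
      partials_agree r (idx M) (a x) (\<lambda>p. b (f (inv_into U a p)) j) (\<lambda>p. b (g (inv_into U a p)) j)"
  shows "same_jet r M N f g x"
  using assms unfolding same_jet_iff by fast

lemma same_jet_refl: "same_jet r M N f f x"
  by (rule same_jetI) (auto simp: partials_agree_refl)

lemma same_jet_sym:
  assumes "same_jet r M N f g x" shows "same_jet r M N g f x"
  using same_jetD(1)[OF assms] by (intro same_jetI partials_agree_sym[OF same_jetD(2)[OF assms]]) auto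

lemma same_jet_trans:
  assumes fg: "same_jet r M N f g x" and gh: "same_jet r M N g h x" shows "same_jet r M N f h x"
proof (rule same_jetI)
  fix U a V b j assume c: "(U, a) \<in> atlas M" "(V, b) \<in> atlas N" "x \<in> U" "f x \<in> V" "j \<in> idx N"
  then have "g x \<in> V" using same_jetD(1)[OF fg] by simp
  with c show "partials_agree r (idx M) (a x) (\<lambda>p. b (f (inv_into U a p)) j) (\<lambda>p. b (h (inv_into U a p)) j)"
    by (intro partials_agree_trans[OF same_jetD(2)[OF fg] same_jetD(2)[OF gh]])
qed (use same_jetD(1)[OF fg] same_jetD(1)[OF gh] in simp)

lemma same_jet_mono:
  assumes "same_jet r M N f g x" "s \<le> r" shows "same_jet s M N f g x"
  by (intro same_jetI partials_agree_mono[OF same_jetD(2)[OF assms(1)] assms(2)] same_jetD(1)[OF assms(1)])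

lemma same_jet_cong:
  assumes "smooth_manifold M" "openin (mtop M) W" "x \<in> W" "\<And>z. z \<in> W \<Longrightarrow> f z = g z"
  shows "same_jet r M N f g x"
proof (rule same_jetI)
  fix U a V b j assume c: "(U, a) \<in> atlas M" "(V, b) \<in> atlas N" "x \<in> U" "f x \<in> V" "j \<in> idx N"
  show "partials_agree r (idx M) (a x) (\<lambda>p. b (f (inv_into U a p)) j) (\<lambda>p. b (g (inv_into U a p)) j)"
    by (rule partials_agree_cong[OF finite_idx[OF assms(1)] chart_open[OF assms(1) c(1) assms(2)]])
      (use c(3) assms(3,4) chart_inv[OF assms(1) c(1)] in auto)
qed (use assms in simp)

text \<open>The chart of N in the middle is inserted for the coordinate computation and cancelled
  afterwards, because the expressions agree near a x. The outer functions are real-valued, which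
  serves both the components of a map and the test functions of tangent vectors.\<close>

lemma partials_agree_compose_maps:
  assumes M: "smooth_manifold M" and N: "smooth_manifold N"
    and f: "smooth_map_on M N W f" and f': "smooth_map_on M N W f'" and x: "x \<in> W"
    and ff': "same_jet r M N f f' x"
    and g: "smooth_fun_on N W' g" and g': "smooth_fun_on N W' g'" and W': "openin (mtop N) W'" and fx: "f x \<in> W'"
    and gg': "\<And>V b. (V, b) \<in> atlas N \<Longrightarrow> f x \<in> V \<Longrightarrow>
      partials_agree r (idx N) (b (f x)) (\<lambda>q. g (inv_into V b q)) (\<lambda>q. g' (inv_into V b q))"
    and c: "(U, a) \<in> atlas M" "x \<in> U"
  shows "partials_agree r (idx M) (a x) (\<lambda>p. g (f (inv_into U a p))) (\<lambda>p. g' (f' (inv_into U a p)))"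
proof -
  obtain V b where V: "(V, b) \<in> atlas N" "f x \<in> V"
    using chart_at[OF N smooth_map_onD(4)[OF f x]] .
  have VW: "openin (mtop N) (V \<inter> W')" using chartD(1)[OF N V(1)] W' by (rule openin_Int)
  \<comment> \<open>Both inner maps must stay in one chart of N and in the domain of the outer
    functions; the common value at x makes this a neighbourhood of x.\<close>
  let ?D = "{z \<in> W. f z \<in> V \<inter> W'} \<inter> {z \<in> W. f' z \<in> V \<inter> W'}"
  let ?S = "a ` (U \<inter> ?D)"
  have S: "opn (idx M) ?S"
    by (rule chart_open[OF M c(1) openin_Int[OF open_preimage[OF f VW] open_preimage[OF f' VW]]])
  have ax: "a x \<in> ?S" using c(2) x V(2) fx same_jetD(1)[OF ff'] by auto
  have i: "inv_into U a p \<in> U \<inter> ?D" if "p \<in> ?S" for p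
    using that chart_inv[OF M c(1)] by auto
  have inv: "inv_into V b (b y) = y" if "y \<in> V" for y by (rule chart_inv[OF N V(1) that])
  have sm: "smooth_real_on (idx M) ?S (\<lambda>p. b (h (inv_into U a p)) j)"
    if "smooth_map_on M N W h" "?D \<subseteq> {z \<in> W. h z \<in> V}" "j \<in> idx N" for h j
    by (rule smooth_fun_onD[OF smooth_fun_on_subset[OF smooth_map_onD(5)[OF that(1) V(1) that(3)] that(2)] c(1)])
  have ix: "inv_into U a (a x) = x" by (rule chart_inv[OF M c])
  have "partials_agree r (idx M) (a x) (\<lambda>p. g (inv_into V b (b (f (inv_into U a p)))))
      (\<lambda>p. g' (inv_into V b (b (f' (inv_into U a p)))))"
  proof (rule partials_agree_compose[of "idx M" "idx N" ?S "b ` (V \<inter> W')" "a x" "\<lambda>p. b (f (inv_into U a p))"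
        "\<lambda>p. b (f' (inv_into U a p))" r "\<lambda>q. g (inv_into V b q)" "\<lambda>q. g' (inv_into V b q)",
        OF finite_idx[OF M] finite_idx[OF N] S chart_open[OF N V(1) W'] ax])
    show "b (f (inv_into U a p)) \<in> b ` (V \<inter> W')" "b (f' (inv_into U a p)) \<in> b ` (V \<inter> W')"
      if "p \<in> ?S" for p using i[OF that] by auto
    show "b (f (inv_into U a (a x))) = b (f' (inv_into U a (a x)))"
      unfolding ix same_jetD(1)[OF ff'] ..
    show "smooth_real_on (idx M) ?S (\<lambda>p. b (f (inv_into U a p)) j)" if "j \<in> idx N" for j
      by (rule sm[OF f _ that]) auto
    show "smooth_real_on (idx M) ?S (\<lambda>p. b (f' (inv_into U a p)) j)" if "j \<in> idx N" for j
      by (rule sm[OF f' _ that]) auto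
    show "partials_agree r (idx M) (a x) (\<lambda>p. b (f (inv_into U a p)) j) (\<lambda>p. b (f' (inv_into U a p)) j)"
      if "j \<in> idx N" for j by (rule same_jetD(2)[OF ff' c(1) V(1) c(2) V(2) that])
    show "partials_agree r (idx N) (b (f (inv_into U a (a x)))) (\<lambda>q. g (inv_into V b q)) (\<lambda>q. g' (inv_into V b q))"
      unfolding ix by (rule gg'[OF V])
  qed (rule smooth_fun_onD[OF g V(1)] smooth_fun_onD[OF g' V(1)])+
  moreover have "partials_agree r (idx M) (a x) (\<lambda>p. g (f (inv_into U a p)))
      (\<lambda>p. g (inv_into V b (b (f (inv_into U a p)))))"
    by (rule partials_agree_cong[OF finite_idx[OF M] S ax], subst inv) (use i in auto)
  moreover have "partials_agree r (idx M) (a x) (\<lambda>p. g' (inv_into V b (b (f' (inv_into U a p)))))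
      (\<lambda>p. g' (f' (inv_into U a p)))"
    by (rule partials_agree_cong[OF finite_idx[OF M] S ax], subst inv) (use i in auto)
  ultimately show ?thesis by (meson partials_agree_trans)
qed

lemma same_jet_compose:
  assumes M: "smooth_manifold M" and N: "smooth_manifold N" and P: "smooth_manifold P"
    and f: "smooth_map_on M N W f" and f': "smooth_map_on M N W f'" and x: "x \<in> W"
    and ff': "same_jet r M N f f' x"
    and g: "smooth_map_on N P W' g" and g': "smooth_map_on N P W' g'" and fx: "f x \<in> W'"
    and gg': "same_jet r N P g g' (f x)"
  shows "same_jet r M P (\<lambda>z. g (f z)) (\<lambda>z. g' (f' z)) x"
proof (rule same_jetI)
  show "g (f x) = g' (f' x)" using same_jetD(1)[OF gg'] same_jetD(1)[OF ff'] by simp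
  fix U a V b j
  assume c: "(U, a) \<in> atlas M" "(V, b) \<in> atlas P" "x \<in> U" "g (f x) \<in> V" "j \<in> idx P"
  \<comment> \<open>Components in the chart V are smooth only where g and g' take values in
    V.\<close>
  let ?D = "{w \<in> W'. g w \<in> V} \<inter> {w \<in> W'. g' w \<in> V}"
  have V: "openin (mtop P) V" by (rule chartD(1)[OF P c(2)])
  show "partials_agree r (idx M) (a x) (\<lambda>p. b (g (f (inv_into U a p))) j) (\<lambda>p. b (g' (f' (inv_into U a p))) j)"
  proof (rule partials_agree_compose_maps[of M N W f f' x r ?D "\<lambda>w. b (g w) j" "\<lambda>w. b (g' w) j",
        OF M N f f' x ff' _ _ _ _ _ c(1,3)])
    show "smooth_fun_on N ?D (\<lambda>w. b (g w) j)"
      by (rule smooth_fun_on_subset[OF smooth_map_onD(5)[OF g c(2,5)]]) blast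
    show "smooth_fun_on N ?D (\<lambda>w. b (g' w) j)"
      by (rule smooth_fun_on_subset[OF smooth_map_onD(5)[OF g' c(2,5)]]) blast
    show "openin (mtop N) ?D"
      by (rule openin_Int[OF open_preimage[OF g V] open_preimage[OF g' V]])
    show "f x \<in> ?D" using fx c(4) same_jetD(1)[OF gg'] by simp
    show "partials_agree r (idx N) (b' (f x)) (\<lambda>q. b (g (inv_into V' b' q)) j) (\<lambda>q. b (g' (inv_into V' b' q)) j)"
      if "(V', b') \<in> atlas N" "f x \<in> V'" for V' b'
      by (rule same_jetD(2)[OF gg' that(1) c(2) that(2) c(4,5)])
  qed
qed

text \<open>
  With \<open>\<sim>\<close> for equality of jets: \<open>g = g' \<circ> f' \<circ> g \<sim> g' \<circ> f \<circ> g = g'\<close>, so composition of jets suffices.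
\<close>

lemma same_jet_inverse:
  assumes M: "smooth_manifold M" and N: "smooth_manifold N"
    and f: "smooth_map_on M N W f" and f': "smooth_map_on M N W f'" and x: "x \<in> W"
    and g: "smooth_map_on N M W' g" and g': "smooth_map_on N M W' g'"
    and gW: "\<And>w. w \<in> W' \<Longrightarrow> g w \<in> W" and fg: "\<And>w. w \<in> W' \<Longrightarrow> f (g w) = w"
    and fW: "\<And>w. w \<in> W \<Longrightarrow> f' w \<in> W'" and gf: "\<And>w. w \<in> W \<Longrightarrow> g' (f' w) = w"
    and fx: "f x \<in> W'" "g (f x) = x"
    and ff': "same_jet r M N f f' x"
  shows "same_jet r N M g g' (f x)"
proof -
  have "same_jet r N M g (\<lambda>w. g' (f' (g w))) (f x)"
    by (rule same_jet_cong[OF N smooth_map_onD(1)[OF g] fx(1)]) (simp add: gf gW)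
  moreover have "same_jet r N M (\<lambda>w. g' (f' (g w))) (\<lambda>w. g' (f (g w))) (f x)"
  proof (rule same_jet_compose[OF N N M _ _ fx(1) _ g' g'])
    show "smooth_map_on N N W' (\<lambda>w. f (g w))" "smooth_map_on N N W' (\<lambda>w. f' (g w))"
      by (rule smooth_map_on_compose[OF N M N g f gW] smooth_map_on_compose[OF N M N g f' gW]; assumption)+
    have "same_jet r M N f f' (g (f x))" using ff' fx by simp
    then show "same_jet r N N (\<lambda>w. f' (g w)) (\<lambda>w. f (g w)) (f x)"
      by (rule same_jet_sym[OF same_jet_compose[OF N M N g g fx(1) same_jet_refl f f' gW[OF fx(1)]]])
    show "f' (g (f x)) \<in> W'" using fx x fW by simp
  qed (rule same_jet_refl)
  moreover have "same_jet r N M (\<lambda>w. g' (f (g w))) g' (f x)"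
    using same_jet_cong[OF N smooth_map_onD(1)[OF g] fx(1), of "\<lambda>w. g' (f (g w))" g'] fg by simp
  ultimately show ?thesis by (meson same_jet_trans)
qed

section \<open>Tangent vectors and pull-back of forms\<close>

lemma smooth_near_cong:
  assumes M: "smooth_manifold M" and W: "openin (mtop M) W" "x \<in> W" and fg: "\<And>z. z \<in> W \<Longrightarrow> f z = g z"
    and f: "f \<in> smooth_near M x"
  shows "g \<in> smooth_near M x"
proof -
  obtain W' where W': "openin (mtop M) W'" "x \<in> W'" "smooth_fun_on M W' f"
    using f unfolding smooth_near_iff by blast
  have "smooth_fun_on M (W' \<inter> W) g"
    by (rule smooth_fun_on_cong[OF M openin_Int[OF W'(1) W(1)] _ smooth_fun_on_subset[OF W'(3)]]) (use fg in auto)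
  then show ?thesis using W W' unfolding smooth_near_iff by (meson IntI openin_Int)
qed

lemma smooth_near_compose:
  assumes M: "smooth_manifold M" and N: "smooth_manifold N" and f: "smooth_map_on M N W f"
    and x: "x \<in> W" and g: "g \<in> smooth_near N (f x)"
  shows "(\<lambda>z. g (f z)) \<in> smooth_near M x"
proof -
  obtain W' where W': "openin (mtop N) W'" "f x \<in> W'" "smooth_fun_on N W' g"
    using g unfolding smooth_near_iff by blast
  note o = open_preimage[OF f W'(1)]
  have "smooth_map_on M N {z \<in> W. f z \<in> W'} f"
    by (rule smooth_map_on_subset[OF f _ o]) auto
  from smooth_fun_on_compose[OF M N this W'(3,1)] have "smooth_fun_on M {z \<in> W. f z \<in> W'} (\<lambda>z. g (f z))" by simp
  with o x W'(2) show ?thesis unfolding smooth_near_iff by blast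
qed

text \<open>A coordinate derivation depends on the germ at x alone, and so does the membership in
  \<open>smooth_near\<close> that decides between derivative and default 0. Identities between
  elements of \<open>Diff\<close> hold on the manifold, not on the whole type, so test functions
  often agree on an open set only.\<close>

lemma tangent_germ:
  assumes M: "smooth_manifold M" and W: "openin (mtop M) W" "x \<in> W" and fg: "\<And>z. z \<in> W \<Longrightarrow> f z = g z"
    and v: "v \<in> tangent_space M x"
  shows "v f = v g"
proof -
  obtain U a w where c: "(U, a) \<in> atlas M" "x \<in> U"
    and v: "v = (\<lambda>f. \<Sum>i\<in>idx M. w i * coord_vec M (U, a) x i f)"
    using v unfolding tangent_space_def by auto
  have "f \<in> smooth_near M x \<longleftrightarrow> g \<in> smooth_near M x"
    using smooth_near_cong[OF M W, of f g] smooth_near_cong[OF M W, of g f] fg by auto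
  moreover have "pd i (\<lambda>p. f (inv_into U a p)) (a x) = pd i (\<lambda>p. g (inv_into U a p)) (a x)"
    if "i \<in> idx M" for i
    by (rule pd_cong[OF finite_idx[OF M] chart_open[OF M c(1) W(1)] _ _ that])
      (use W(2) c fg chart_inv[OF M c(1)] in auto)
  ultimately show ?thesis unfolding v coord_vec_def by (auto intro!: sum.cong)
qed

text \<open>By the chain rule the coefficients in a chart at s x are the Jacobian of s applied to w;
  on functions that are not smooth near s x both sides are 0. Composition of pull-backs rests on
  this, since a pull-back returns 0 outside \<open>frames_at\<close>.\<close>

lemma push_vec_tangent:
  assumes M: "smooth_manifold M" and s: "smooth_map_on M M W s" and x: "x \<in> W"
    and v: "v \<in> tangent_space M x"
  shows "push_vec M s x v \<in> tangent_space M (s x)"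
proof -
  obtain U a w where c: "(U, a) \<in> atlas M" "x \<in> U"
    and v: "v = (\<lambda>f. \<Sum>i\<in>idx M. w i * coord_vec M (U, a) x i f)"
    using v unfolding tangent_space_def by auto
  obtain V b where V: "(V, b) \<in> atlas M" "s x \<in> V"
    using chart_at[OF M smooth_map_onD(4)[OF s x]] .
  let ?u = "\<lambda>p. b (s (inv_into U a p))"
  define w' where "w' j = (\<Sum>i\<in>idx M. w i * pd i (\<lambda>p. ?u p j) (a x))" for j
  have ix: "inv_into U a (a x) = x" by (rule chart_inv[OF M c])
  have "push_vec M s x v f = (\<Sum>j\<in>idx M. w' j * coord_vec M (V, b) (s x) j f)" for f
  proof (cases "f \<in> smooth_near M (s x)")
    case True
    then obtain W' where W': "openin (mtop M) W'" "s x \<in> W'" "smooth_fun_on M W' f"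
      unfolding smooth_near_iff by blast
    let ?l = "\<lambda>q. f (inv_into V b q)"
    let ?D = "{z \<in> W. s z \<in> V \<inter> W'}"
    let ?S = "a ` (U \<inter> ?D)"
    have S: "opn (idx M) ?S"
      by (rule chart_open[OF M c(1) open_preimage[OF s openin_Int[OF chartD(1)[OF M V(1)] W'(1)]]])
    have ax: "a x \<in> ?S" using c(2) x V(2) W'(2) by auto
    have i: "inv_into U a p \<in> U \<inter> ?D" if "p \<in> ?S" for p
      using that chart_inv[OF M c(1)] by auto
    have u: "smooth_real_on (idx M) ?S (\<lambda>p. ?u p j)" if "j \<in> idx M" for j
      by (rule smooth_fun_onD[OF smooth_fun_on_subset[OF smooth_map_onD(5)[OF s V(1) that]] c(1)]) auto
    have uB: "?u p \<in> b ` (V \<inter> W')" if "p \<in> ?S" for p using i[OF that] by auto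
    have pdi: "pd i (\<lambda>p. f (s (inv_into U a p))) (a x) =
        (\<Sum>j\<in>idx M. pd j ?l (b (s x)) * pd i (\<lambda>p. ?u p j) (a x))" if "i \<in> idx M" for i
    proof -
      have "pd i (\<lambda>p. f (s (inv_into U a p))) (a x) = pd i (\<lambda>p. ?l (?u p)) (a x)"
      proof (rule pd_cong[OF finite_idx[OF M] S _ ax that])
        show "f (s (inv_into U a p)) = ?l (?u p)" if "p \<in> ?S" for p
          using i[OF that] by (subst chart_inv[OF M V(1)]) auto
      qed
      also have "\<dots> = (\<Sum>j\<in>idx M. pd j ?l (?u (a x)) * pd i (\<lambda>p. ?u p j) (a x))"
        by (rule pd_compose(2)[of "idx M" "idx M" ?S "b ` (V \<inter> W')" ?u ?l, OF finite_idx[OF M]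
              finite_idx[OF M] S chart_open[OF M V(1) W'(1)] uB smooth_C1[OF u]
              smooth_C1[OF smooth_fun_onD[OF W'(3) V(1)]] ax that])
      finally show ?thesis unfolding ix .
    qed
    have "(\<lambda>z. f (s z)) \<in> smooth_near M x" by (rule smooth_near_compose[OF M M s x True])
    then have "push_vec M s x v f = (\<Sum>i\<in>idx M. w i * pd i (\<lambda>p. f (s (inv_into U a p))) (a x))"
      using True by (simp add: push_vec_def v coord_vec_def o_def)
    also have "\<dots> = (\<Sum>i\<in>idx M. \<Sum>j\<in>idx M. w i * pd i (\<lambda>p. ?u p j) (a x) * pd j ?l (b (s x)))"
      by (rule sum.cong) (auto simp: pdi sum_distrib_left mult_ac)
    also have "\<dots> = (\<Sum>j\<in>idx M. w' j * pd j ?l (b (s x)))"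
      by (subst sum.swap) (simp add: w'_def sum_distrib_right)
    also have "\<dots> = (\<Sum>j\<in>idx M. w' j * coord_vec M (V, b) (s x) j f)"
      using True by (simp add: coord_vec_def)
    finally show ?thesis .
  qed (simp add: push_vec_def coord_vec_def)
  then have "push_vec M s x v = (\<lambda>f. \<Sum>j\<in>idx M. w' j * coord_vec M (V, b) (s x) j f)" by blast
  then show ?thesis using V unfolding tangent_space_def by force
qed

text \<open>The composition result at order 1, with the same test function outside on both sides,
  gives equal first derivatives of f o s and f o s' in a chart at x. No higher derivative of s
  enters a tangent map.\<close>

lemma push_vec_jet:
  assumes M: "smooth_manifold M" and s: "smooth_map_on M M W s" and s': "smooth_map_on M M W s'"
    and x: "x \<in> W" and v: "v \<in> tangent_space M x" and ss': "same_jet 1 M M s s' x"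
  shows "push_vec M s x v = push_vec M s' x v"
proof
  fix f
  obtain U a w where c: "(U, a) \<in> atlas M" "x \<in> U"
    and v: "v = (\<lambda>f. \<Sum>i\<in>idx M. w i * coord_vec M (U, a) x i f)"
    using v unfolding tangent_space_def by auto
  note e = same_jetD(1)[OF ss']
  show "push_vec M s x v f = push_vec M s' x v f"
  proof (cases "f \<in> smooth_near M (s x)")
    case True
    then obtain W' where W': "openin (mtop M) W'" "s x \<in> W'" "smooth_fun_on M W' f"
      unfolding smooth_near_iff by blast
    have "partials_agree 1 (idx M) (a x) (\<lambda>p. f (s (inv_into U a p))) (\<lambda>p. f (s' (inv_into U a p)))"
      by (rule partials_agree_compose_maps[OF M M s s' x ss' W'(3,3,1,2) partials_agree_refl c])
    then have "pd i (\<lambda>p. f (s (inv_into U a p))) (a x) = pd i (\<lambda>p. f (s' (inv_into U a p))) (a x)"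
      if "i \<in> idx M" for i
      using that partials_agree_value unfolding One_nat_def partials_agree_Suc by blast
    moreover have "(\<lambda>z. f (s z)) \<in> smooth_near M x" by (rule smooth_near_compose[OF M M s x True])
    moreover have "(\<lambda>z. f (s' z)) \<in> smooth_near M x"
      using smooth_near_compose[OF M M s' x] True e by simp
    ultimately show ?thesis using True e by (simp add: push_vec_def v coord_vec_def o_def)
  qed (simp add: push_vec_def e)
qed

lemma pull_form_jet:
  assumes "smooth_manifold M" "smooth_map_on M M W s" "smooth_map_on M M W s'" "x \<in> W"
    "same_jet 1 M M s s' x"
  shows "pull_form M s x \<omega> = pull_form M s' x \<omega>"
proof
  fix vs
  have "map (push_vec M s x) vs = map (push_vec M s' x) vs" if "vs \<in> frames_at M x"
    using that push_vec_jet[OF assms(1-4) _ assms(5)] by (auto simp: frames_at_def)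
  then show "pull_form M s x \<omega> vs = pull_form M s' x \<omega> vs" unfolding pull_form_def by metis
qed

text \<open>Vectors pushed by t are tangent at t x, so they pass the guard in the pull-back by s.
  That u equals the composite on W only makes the lemma applicable to the extensional composites of
  \<open>Diff\<close>.\<close>

lemma pull_form_compose:
  assumes M: "smooth_manifold M" and t: "smooth_map_on M M W t" and s: "smooth_map_on M M W' s"
    and x: "x \<in> W" and tW: "\<And>z. z \<in> W \<Longrightarrow> t z \<in> W'" and u: "\<And>z. z \<in> W \<Longrightarrow> u z = s (t z)"
  shows "pull_form M u x \<omega> = pull_form M t x (pull_form M s (t x) \<omega>)"
proof
  fix vs
  have "push_vec M s (t x) (push_vec M t x v) = push_vec M u x v" if "v \<in> tangent_space M x" for v
  proof
    fix f
    show "push_vec M s (t x) (push_vec M t x v) f = push_vec M u x v f"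
    proof (cases "f \<in> smooth_near M (s (t x))")
      case True
      have "(\<lambda>z. f (s z)) \<in> smooth_near M (t x)"
        by (rule smooth_near_compose[OF M M s tW[OF x] True])
      moreover have "v (\<lambda>z. f (s (t z))) = v (\<lambda>z. f (u z))"
        by (rule tangent_germ[OF M smooth_map_onD(1)[OF t] x _ that]) (simp add: u)
      ultimately show ?thesis using True by (simp add: push_vec_def o_def u[OF x])
    qed (simp add: push_vec_def u[OF x])
  qed
  then have "map (push_vec M s (t x)) (map (push_vec M t x) vs) = map (push_vec M u x) vs"
    if "vs \<in> frames_at M x" using that by (auto simp: frames_at_def)
  moreover have "map (push_vec M t x) vs \<in> frames_at M (t x)" if "vs \<in> frames_at M x"
    using that push_vec_tangent[OF M t x] by (auto simp: frames_at_def)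
  ultimately show "pull_form M u x \<omega> vs = pull_form M t x (pull_form M s (t x) \<omega>) vs"
    unfolding pull_form_def by metis
qed

section \<open>The fibre product\<close>

lemma Ytilde_chart:
  "(U, a) \<in> atlas X \<Longrightarrow> (V, b) \<in> atlas Y \<Longrightarrow>
    ({(x, xb, y). xb \<in> U \<and> y \<in> V \<and> \<pi> y = x}, \<lambda>(x, xb, y). case_sum (a xb) (b y)) \<in> atlas (Ytilde X Y \<pi>)"
  unfolding Ytilde_def by auto

lemma Ytilde_chartE:
  assumes "(C, c) \<in> atlas (Ytilde X Y \<pi>)"
  obtains U a V b where "(U, a) \<in> atlas X" "(V, b) \<in> atlas Y"
    "C = {(x, xb, y). xb \<in> U \<and> y \<in> V \<and> \<pi> y = x}" "c = (\<lambda>(x, xb, y). case_sum (a xb) (b y))"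
  using assms unfolding Ytilde_def by auto

lemma Ytilde_idx: "idx (Ytilde X Y \<pi>) = idx X <+> idx Y"
  by (simp add: Ytilde_def)

text \<open>Maps into the fibre product are studied through their entries in X and Y. A chart of
  \<open>Ytilde\<close> combines a chart of X with one of Y, so at first an entry is known to be
  smooth only where the other one stays in a fixed chart; locality of smoothness removes this
  restriction.\<close>

lemma smooth_map_Ytilde_components:
  assumes X: "smooth_manifold X" and Y: "smooth_manifold Y"
    and \<psi>: "smooth_map_on X (Ytilde X Y \<pi>) W \<psi>"
  shows "z \<in> W \<Longrightarrow> \<pi> (snd (snd (\<psi> z))) = fst (\<psi> z)"
    and "smooth_map_on X X W (\<lambda>z. fst (snd (\<psi> z)))"
    and "smooth_map_on X Y W (\<lambda>z. snd (snd (\<psi> z)))"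
proof -
  note D = smooth_map_onD[OF \<psi>]
  have c: "continuous_map (subtopology (mtop X) W) (prod_topology (mtop X) (prod_topology (mtop X) (mtop Y))) \<psi>"
    and m: "\<psi> \<in> pts X \<inter> W \<rightarrow> {(x, xb, y). \<pi> y = x}"
    using D(2) by (simp_all add: Ytilde_def continuous_map_in_subtopology image_subset_iff_funcset)
  have p: "\<pi> (snd (snd (\<psi> z))) = fst (\<psi> z)" if "z \<in> W" for z
  proof -
    have "\<psi> z \<in> {(x, xb, y). \<pi> y = x}" by (rule Pi_mem[OF m]) (use that D(3) in blast)
    then show ?thesis by (auto simp: split_beta)
  qed
  show "z \<in> W \<Longrightarrow> \<pi> (snd (snd (\<psi> z))) = fst (\<psi> z)" by (rule p)
  have c1: "continuous_map (subtopology (mtop X) W) (mtop X) (\<lambda>z. fst (snd (\<psi> z)))"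
    and c2: "continuous_map (subtopology (mtop X) W) (mtop Y) (\<lambda>z. snd (snd (\<psi> z)))"
    using c by (auto simp: continuous_map_pairwise o_def)
  have W: "topspace (subtopology (mtop X) W) = W" using D(3) by auto
  have o1: "openin (mtop X) {z \<in> W. fst (snd (\<psi> z)) \<in> U}" if "openin (mtop X) U" for U
    using openin_continuous_map_preimage[OF c1 that] D(1) unfolding W by (rule openin_trans_full)
  have o2: "openin (mtop X) {z \<in> W. snd (snd (\<psi> z)) \<in> V}" if "openin (mtop Y) V" for V
    using openin_continuous_map_preimage[OF c2 that] D(1) unfolding W by (rule openin_trans_full)
  have m1: "fst (snd (\<psi> z)) \<in> pts X" and m2: "snd (snd (\<psi> z)) \<in> pts Y" if "z \<in> W" for z
    using continuous_map_image_subset_topspace[OF c1] continuous_map_image_subset_topspace[OF c2] that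
    unfolding W by auto
  have s: "smooth_fun_on X {z \<in> W. fst (snd (\<psi> z)) \<in> U \<and> snd (snd (\<psi> z)) \<in> V}
      (\<lambda>z. case_sum (a (fst (snd (\<psi> z)))) (b (snd (snd (\<psi> z)))) j)"
    if "(U, a) \<in> atlas X" "(V, b) \<in> atlas Y" "j \<in> idx X <+> idx Y" for U a V b j
    using smooth_fun_on_subset[OF D(5)[OF Ytilde_chart[OF that(1,2)], unfolded Ytilde_idx, OF that(3)],
        of "{z \<in> W. fst (snd (\<psi> z)) \<in> U \<and> snd (snd (\<psi> z)) \<in> V}"] p
    by (auto simp: split_beta)
  show "smooth_map_on X X W (\<lambda>z. fst (snd (\<psi> z)))"
    unfolding smooth_map_on_iff
  proof (intro conjI D(1) c1; clarify)
    fix U a j assume U: "(U, a) \<in> atlas X" and j: "j \<in> idx X"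
    show "smooth_fun_on X {z \<in> W. fst (snd (\<psi> z)) \<in> U} (\<lambda>z. a (fst (snd (\<psi> z))) j)"
    proof (rule smooth_fun_on_local[OF X])
      fix z assume z: "z \<in> {z \<in> W. fst (snd (\<psi> z)) \<in> U}"
      then obtain V b where V: "(V, b) \<in> atlas Y" "snd (snd (\<psi> z)) \<in> V"
        using chart_at[OF Y m2] by blast
      have "smooth_fun_on X ({z \<in> W. fst (snd (\<psi> z)) \<in> U} \<inter> {z \<in> W. snd (snd (\<psi> z)) \<in> V})
          (\<lambda>z. a (fst (snd (\<psi> z))) j)"
        by (rule smooth_fun_on_subset[OF s[OF U V(1) InlI[OF j], unfolded sum.case]]) auto
      with o2[OF chartD(1)[OF Y V(1)]] z V(2)
      show "\<exists>W'. openin (mtop X) W' \<and> z \<in> W' \<and>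
          smooth_fun_on X ({z \<in> W. fst (snd (\<psi> z)) \<in> U} \<inter> W') (\<lambda>z. a (fst (snd (\<psi> z))) j)" by blast
    qed
  qed
  show "smooth_map_on X Y W (\<lambda>z. snd (snd (\<psi> z)))"
    unfolding smooth_map_on_iff
  proof (intro conjI D(1) c2; clarify)
    fix V b j assume V: "(V, b) \<in> atlas Y" and j: "j \<in> idx Y"
    show "smooth_fun_on X {z \<in> W. snd (snd (\<psi> z)) \<in> V} (\<lambda>z. b (snd (snd (\<psi> z))) j)"
    proof (rule smooth_fun_on_local[OF X])
      fix z assume z: "z \<in> {z \<in> W. snd (snd (\<psi> z)) \<in> V}"
      then obtain U a where U: "(U, a) \<in> atlas X" "fst (snd (\<psi> z)) \<in> U"
        using chart_at[OF X m1] by blast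
      have "smooth_fun_on X ({z \<in> W. snd (snd (\<psi> z)) \<in> V} \<inter> {z \<in> W. fst (snd (\<psi> z)) \<in> U})
          (\<lambda>z. b (snd (snd (\<psi> z))) j)"
        by (rule smooth_fun_on_subset[OF s[OF U(1) V InrI[OF j], unfolded sum.case]]) auto
      with o1[OF chartD(1)[OF X U(1)]] z U(2)
      show "\<exists>W'. openin (mtop X) W' \<and> z \<in> W' \<and>
          smooth_fun_on X ({z \<in> W. snd (snd (\<psi> z)) \<in> V} \<inter> W') (\<lambda>z. b (snd (snd (\<psi> z))) j)" by blast
    qed
  qed
qed

text \<open>The charts of \<open>Ytilde\<close> take no coordinates from the first entry, which is
  the identity here; the section property of \<phi> places the values in the fibre product.\<close>

lemma smooth_map_pair_section:
  assumes f: "smooth_map_on X X W f" and \<phi>: "smooth_map_on X Y W \<phi>"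
    and \<pi>: "\<And>z. z \<in> W \<Longrightarrow> \<pi> (\<phi> z) = z"
  shows "smooth_map_on X (Ytilde X Y \<pi>) W (pair_section f \<phi>)"
  unfolding smooth_map_on_iff
proof (intro conjI)
  note F = smooth_map_onD[OF f] and P = smooth_map_onD[OF \<phi>]
  show "openin (mtop X) W" by (rule F(1))
  have "continuous_map (subtopology (mtop X) W) (mtop X) (\<lambda>z. z)"
    using continuous_map_from_subtopology[OF continuous_map_id] by (simp add: id_def)
  then have "continuous_map (subtopology (mtop X) W) (prod_topology (mtop X) (prod_topology (mtop X) (mtop Y)))
      (\<lambda>z. (z, f z, \<phi> z))"
    using F(2) P(2) by (simp add: continuous_map_paired)
  then show "continuous_map (subtopology (mtop X) W) (mtop (Ytilde X Y \<pi>)) (pair_section f \<phi>)"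
    using \<pi> by (auto simp: Ytilde_def continuous_map_in_subtopology pair_section_def[abs_def])
  show "\<forall>(C, c)\<in>atlas (Ytilde X Y \<pi>). \<forall>j\<in>idx (Ytilde X Y \<pi>).
      smooth_fun_on X {z \<in> W. pair_section f \<phi> z \<in> C} (\<lambda>z. c (pair_section f \<phi> z) j)"
  proof clarify
    fix C c j assume "(C, c) \<in> atlas (Ytilde X Y \<pi>)" and j: "j \<in> idx (Ytilde X Y \<pi>)"
    then obtain U a V b where c: "(U, a) \<in> atlas X" "(V, b) \<in> atlas Y"
      "C = {(x, xb, y). xb \<in> U \<and> y \<in> V \<and> \<pi> y = x}" "c = (\<lambda>(x, xb, y). case_sum (a xb) (b y))"
      by (elim Ytilde_chartE)
    show "smooth_fun_on X {z \<in> W. pair_section f \<phi> z \<in> C} (\<lambda>z. c (pair_section f \<phi> z) j)"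
    proof (cases j)
      case (Inl i)
      with j have "i \<in> idx X" by (auto simp: Ytilde_idx)
      from smooth_fun_on_subset[OF F(5)[OF c(1) this], of "{z \<in> W. pair_section f \<phi> z \<in> C}"]
      show ?thesis using Inl by (auto simp: c pair_section_def)
    next
      case (Inr i)
      with j have "i \<in> idx Y" by (auto simp: Ytilde_idx)
      from smooth_fun_on_subset[OF P(5)[OF c(2) this], of "{z \<in> W. pair_section f \<phi> z \<in> C}"]
      show ?thesis using Inr by (auto simp: c pair_section_def)
    qed
  qed
qed

text \<open>Charts of \<open>Ytilde\<close> do not record the first entry, whereas
  \<open>same_jet\<close> asks for equal values at x; hence the separate hypothesis on it.\<close>

lemma same_jet_YtildeI:
  assumes "fst (f x) = fst (g x)"
    and 1: "same_jet r X X (\<lambda>z. fst (snd (f z))) (\<lambda>z. fst (snd (g z))) x"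
    and 2: "same_jet r X Y (\<lambda>z. snd (snd (f z))) (\<lambda>z. snd (snd (g z))) x"
  shows "same_jet r X (Ytilde X Y \<pi>) f g x"
proof (rule same_jetI)
  show "f x = g x" using assms(1) same_jetD(1)[OF 1] same_jetD(1)[OF 2] by (simp add: prod_eq_iff)
  fix U' a' C c j
  assume U': "(U', a') \<in> atlas X" "x \<in> U'" and fx: "f x \<in> C" and j: "j \<in> idx (Ytilde X Y \<pi>)"
    and "(C, c) \<in> atlas (Ytilde X Y \<pi>)"
  then obtain U a V b where c: "(U, a) \<in> atlas X" "(V, b) \<in> atlas Y"
    "C = {(x, xb, y). xb \<in> U \<and> y \<in> V \<and> \<pi> y = x}" "c = (\<lambda>(x, xb, y). case_sum (a xb) (b y))"
    by (elim Ytilde_chartE)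
  have m: "fst (snd (f x)) \<in> U" "snd (snd (f x)) \<in> V" using fx by (auto simp: c)
  show "partials_agree r (idx X) (a' x) (\<lambda>p. c (f (inv_into U' a' p)) j) (\<lambda>p. c (g (inv_into U' a' p)) j)"
  proof (cases j)
    case (Inl i)
    with j have "i \<in> idx X" by (auto simp: Ytilde_idx)
    from same_jetD(2)[OF 1 U'(1) c(1) U'(2) m(1) this] show ?thesis
      using Inl by (simp add: c split_beta)
  next
    case (Inr i)
    with j have "i \<in> idx Y" by (auto simp: Ytilde_idx)
    from same_jetD(2)[OF 2 U'(1) c(2) U'(2) m(2) this] show ?thesis
      using Inr by (simp add: c split_beta)
  qed
qed

text \<open>The conditions on f x put it into the combined domain of any chart of X and any chart of
  Y around its entries. Choosing one of the two charts freely isolates the other entry.\<close>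

lemma same_jet_YtildeD:
  assumes X: "smooth_manifold X" and Y: "smooth_manifold Y"
    and fg: "same_jet r X (Ytilde X Y \<pi>) f g x"
    and m: "fst (snd (f x)) \<in> pts X" "snd (snd (f x)) \<in> pts Y" "\<pi> (snd (snd (f x))) = fst (f x)"
  shows "same_jet r X X (\<lambda>z. fst (snd (f z))) (\<lambda>z. fst (snd (g z))) x"
    and "same_jet r X Y (\<lambda>z. snd (snd (f z))) (\<lambda>z. snd (snd (g z))) x"
proof -
  have *: "partials_agree r (idx X) (a' x) (\<lambda>p. case_sum (a (fst (snd (f (inv_into U' a' p))))) (b (snd (snd (f (inv_into U' a' p))))) j)
      (\<lambda>p. case_sum (a (fst (snd (g (inv_into U' a' p))))) (b (snd (snd (g (inv_into U' a' p))))) j)"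
    if "(U', a') \<in> atlas X" "x \<in> U'" "(U, a) \<in> atlas X" "fst (snd (f x)) \<in> U"
      "(V, b) \<in> atlas Y" "snd (snd (f x)) \<in> V" "j \<in> idx X <+> idx Y" for U' a' U a V b j
    using same_jetD(2)[OF fg that(1) Ytilde_chart[OF that(3,5)] that(2), of j] that(4,6,7) m(3)
    by (simp add: Ytilde_idx split_beta)
  show "same_jet r X X (\<lambda>z. fst (snd (f z))) (\<lambda>z. fst (snd (g z))) x"
  proof (rule same_jetI)
    fix U' a' U a j
    assume c: "(U', a') \<in> atlas X" "(U, a) \<in> atlas X" "x \<in> U'" "fst (snd (f x)) \<in> U" and j: "j \<in> idx X"
    obtain V b where V: "(V, b) \<in> atlas Y" "snd (snd (f x)) \<in> V" using chart_at[OF Y m(2)] .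
    show "partials_agree r (idx X) (a' x) (\<lambda>p. a (fst (snd (f (inv_into U' a' p)))) j)
        (\<lambda>p. a (fst (snd (g (inv_into U' a' p)))) j)"
      using *[OF c(1,3,2,4) V InlI[OF j]] by simp
  qed (simp add: same_jetD(1)[OF fg])
  show "same_jet r X Y (\<lambda>z. snd (snd (f z))) (\<lambda>z. snd (snd (g z))) x"
  proof (rule same_jetI)
    fix U' a' V b j
    assume c: "(U', a') \<in> atlas X" "(V, b) \<in> atlas Y" "x \<in> U'" "snd (snd (f x)) \<in> V" and j: "j \<in> idx Y"
    obtain U a where U: "(U, a) \<in> atlas X" "fst (snd (f x)) \<in> U" using chart_at[OF X m(1)] .
    show "partials_agree r (idx X) (a' x) (\<lambda>p. b (snd (snd (f (inv_into U' a' p)))) j)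
        (\<lambda>p. b (snd (snd (g (inv_into U' a' p)))) j)"
      using *[OF c(1,3) U c(2,4) InrI[OF j]] by simp
  qed (simp add: same_jetD(1)[OF fg])
qed

section \<open>Diffeomorphisms and their action on jets\<close>

lemma DiffD:
  assumes "f \<in> carrier (Diff M)"
  shows "bij_betw f (pts M) (pts M)" "f \<in> extensional (pts M)" "f \<in> Bij (pts M)"
    "smooth_map_on M M (pts M) f" "smooth_map_on M M (pts M) (inv_into (pts M) f)"
  using assms by (auto simp: Diff_def diffeo_on_def Bij_def)

lemma Diff_apply:
  assumes "f \<in> carrier (Diff M)"
  shows "z \<in> pts M \<Longrightarrow> f z \<in> pts M" "z \<in> pts M \<Longrightarrow> inv_into (pts M) f z \<in> pts M"
    "z \<in> pts M \<Longrightarrow> f (inv_into (pts M) f z) = z" "z \<in> pts M \<Longrightarrow> inv_into (pts M) f (f z) = z"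
  using DiffD(1)[OF assms]
  by (auto simp: bij_betw_def inv_into_into f_inv_into_f)

text \<open>The extensional composite agrees with the plain one, and its inverse with the composite
  of the inverses in reverse order, on the points of M; smoothness is insensitive to the
  rest.\<close>

lemma compose_Diff:
  assumes M: "smooth_manifold M" and f: "f \<in> carrier (Diff M)" and g: "g \<in> carrier (Diff M)"
  shows "compose (pts M) f g \<in> carrier (Diff M)"
proof -
  have B: "compose (pts M) f g \<in> Bij (pts M)" by (rule compose_Bij[OF DiffD(3)[OF f] DiffD(3)[OF g]])
  then have b: "bij_betw (compose (pts M) f g) (pts M) (pts M)" by (simp add: Bij_def)
  have "smooth_map_on M M (pts M) (compose (pts M) f g)"
    by (rule smooth_map_on_cong[OF M M smooth_map_on_compose[OF M M M DiffD(4)[OF g] DiffD(4)[OF f] Diff_apply(1)[OF g]]])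
      (simp_all add: compose_eq)
  moreover have "smooth_map_on M M (pts M) (inv_into (pts M) (compose (pts M) f g))"
  proof (rule smooth_map_on_cong[OF M M smooth_map_on_compose[OF M M M DiffD(5)[OF f] DiffD(5)[OF g] Diff_apply(2)[OF f]]])
    show "inv_into (pts M) g (inv_into (pts M) f z) = inv_into (pts M) (compose (pts M) f g) z" if "z \<in> pts M" for z
      using b that Diff_apply[OF f] Diff_apply[OF g]
      by (intro inv_into_f_eq[symmetric]) (auto simp: bij_betw_def compose_eq)
  qed
  ultimately show ?thesis using B b by (simp add: Diff_def diffeo_on_def)
qed

lemma inv_Diff:
  assumes M: "smooth_manifold M" and f: "f \<in> carrier (Diff M)"
  shows "restrict (inv_into (pts M) f) (pts M) \<in> carrier (Diff M)"
proof -
  let ?g = "restrict (inv_into (pts M) f) (pts M)"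
  have B: "?g \<in> Bij (pts M)" by (rule restrict_inv_into_Bij[OF DiffD(3)[OF f]])
  then have b: "bij_betw ?g (pts M) (pts M)" by (simp add: Bij_def)
  have "smooth_map_on M M (pts M) ?g"
    by (rule smooth_map_on_cong[OF M M DiffD(5)[OF f]]) simp
  moreover have "smooth_map_on M M (pts M) (inv_into (pts M) ?g)"
  proof (rule smooth_map_on_cong[OF M M DiffD(4)[OF f]])
    show "f z = inv_into (pts M) ?g z" if "z \<in> pts M" for z
      using b that Diff_apply[OF f] by (intro inv_into_f_eq[symmetric]) (auto simp: bij_betw_def)
  qed
  ultimately show ?thesis using B b by (simp add: Diff_def diffeo_on_def)
qed

lemma finite_jet_idx: "finite I \<Longrightarrow> finite J \<Longrightarrow> finite (jet_idx r I J)"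
  unfolding jet_idx_def
  by (intro finite_Plus finite_cartesian_product finite_subset[OF _ finite_lists_length_le[of I r]]) auto

text \<open>In charts both sides are the same smooth function l of coordinates along the sections:
  base coordinates, derivatives of the diffeomorphism up to order k, and fibre coordinates. It
  remains to compare the r-jets of these coordinate functions and to compose with l.\<close>

lemma same_jet_action:
  fixes X :: "('x, nat) manifold" and Y :: "('y, 'j) manifold"
  assumes X: "smooth_manifold X" and Y: "smooth_manifold Y" and di: "differential_index k X Y \<pi> A"
    and \<eta>: "\<eta> \<in> carrier (Diff X)" and \<eta>': "\<eta>' \<in> carrier (Diff X)"
    and \<phi>: "smooth_map_on X Y W \<phi>" "\<And>z. z \<in> W \<Longrightarrow> \<pi> (\<phi> z) = z"
    and \<phi>': "smooth_map_on X Y W \<phi>'" "\<And>z. z \<in> W \<Longrightarrow> \<pi> (\<phi>' z) = z"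
    and x: "x \<in> W" and j\<eta>: "same_jet (k + r) X X \<eta> \<eta>' x" and j\<phi>: "same_jet (k + r) X Y \<phi> \<phi>' x"
  shows "same_jet r X Y (\<lambda>z. A \<eta> (\<phi> z)) (\<lambda>z. A \<eta>' (\<phi>' z)) x"
proof (rule same_jetI)
  have xX: "x \<in> pts X" using smooth_map_onD(3)[OF \<phi>(1)] x by blast
  have "same_jet k X X \<eta> \<eta>' (\<pi> (\<phi> x))"
    using same_jet_mono[OF j\<eta>, of k] \<phi>(2)[OF x] by simp
  then have "A \<eta> (\<phi> x) = A \<eta>' (\<phi> x)"
    using di \<eta> \<eta>' smooth_map_onD(4)[OF \<phi>(1) x] unfolding differential_index_def by blast
  then show "A \<eta> (\<phi> x) = A \<eta>' (\<phi>' x)" using same_jetD(1)[OF j\<phi>] by simp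
  fix U a V2 b2 j
  assume U: "(U, a) \<in> atlas X" and V2: "(V2, b2) \<in> atlas Y" and xU: "x \<in> U"
    and AV2: "A \<eta> (\<phi> x) \<in> V2" and j: "j \<in> idx Y"
  obtain U' a' where U': "(U', a') \<in> atlas X" "\<eta> x \<in> U'"
    using chart_at[OF X Diff_apply(1)[OF \<eta> xX]] .
  obtain V b where V: "(V, b) \<in> atlas Y" "\<phi> x \<in> V"
    using chart_at[OF Y smooth_map_onD(4)[OF \<phi>(1) x]] .
  define K where "K = jet_idx k (idx X) (idx X) <+> idx Y"
  define C where "C \<sigma> y = case_sum (jet_coords k X X (U, a) a' \<sigma> (\<pi> y)) (b y)" for \<sigma> y
  define D where "D = {(\<sigma>, y). \<sigma> \<in> carrier (Diff X) \<and> y \<in> V \<and> \<pi> y \<in> U \<and> \<sigma> (\<pi> y) \<in> U'}"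
  have "smooth_in_coords K D (\<lambda>(\<sigma>, y). C \<sigma> y) Y (\<lambda>(\<sigma>, y). A \<sigma> y)"
    using di U U'(1) V(1) unfolding differential_index_def K_def D_def C_def by fast
  moreover have "(\<eta>, \<phi> x) \<in> D" using \<eta> V(2) \<phi>(2)[OF x] xU U'(2) by (simp add: D_def)
  \<comment> \<open>The function l is found at (\<eta>, \<phi> x), but it computes the action for
    every diffeomorphism and every point of D whose coordinates lie in B. Hence it serves \<eta>'
    and \<phi>' as well.\<close>
  ultimately obtain B l where B: "opn K B" "C \<eta> (\<phi> x) \<in> B"
    and l: "\<And>j. j \<in> idx Y \<Longrightarrow> smooth_real_on K B (l j)"
    and Al: "\<And>\<sigma> y. (\<sigma>, y) \<in> D \<Longrightarrow> C \<sigma> y \<in> B \<Longrightarrow> b2 (A \<sigma> y) j = l j (C \<sigma> y)"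
    using V2 AV2 j unfolding smooth_in_coords_def by fast
  let ?i = "inv_into U a" and ?I = "idx X"
  let ?N = "({z \<in> W. \<phi> z \<in> V} \<inter> {z \<in> W. \<phi>' z \<in> V}) \<inter> ({z \<in> pts X. \<eta> z \<in> U'} \<inter> {z \<in> pts X. \<eta>' z \<in> U'})"
  define S0 where "S0 = a ` (U \<inter> ?N)"
  have oV: "openin (mtop Y) V" and oU': "openin (mtop X) U'"
    using chartD(1)[OF Y V(1)] chartD(1)[OF X U'(1)] by auto
  have S0: "opn ?I S0" unfolding S0_def
    by (intro chart_open[OF X U] openin_Int open_preimage[OF _ oV] open_preimage[OF _ oU'] \<phi>(1) \<phi>'(1)
        DiffD(4)[OF \<eta>] DiffD(4)[OF \<eta>'])
  have fI: "finite ?I" and fK: "finite K"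
    using finite_idx[OF X] finite_idx[OF Y] by (auto simp: K_def finite_jet_idx)
  have ax: "a x \<in> S0"
    using xU x xX U'(2) V(2) same_jetD(1)[OF j\<eta>] same_jetD(1)[OF j\<phi>] by (auto simp: S0_def)
  have ix: "?i (a x) = x" by (rule chart_inv[OF X U xU])
  have inS0: "?i p \<in> U \<inter> ?N \<and> a (?i p) = p" if "p \<in> S0" for p
    using that chart_inv[OF X U] by (auto simp: S0_def)
  \<comment> \<open>The coordinates \<open>C\<close> along a section, written as functions of the base coordinates alone.\<close>
  define G where "G \<sigma> \<psi> \<kappa> = (case \<kappa> of
      Inl (Inl i) \<Rightarrow> (\<lambda>p. p i)
    | Inl (Inr (j, is)) \<Rightarrow> iter_pd is (\<lambda>p. a' (\<sigma> (?i p)) j)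
    | Inr j \<Rightarrow> (\<lambda>p. b (\<psi> (?i p)) j))" for \<sigma> :: "'x \<Rightarrow> 'x" and \<psi> :: "'x \<Rightarrow> 'y" and \<kappa> :: "(nat + nat \<times> nat list) + 'j"
  have K_cases [consumes 1]: thesis if "\<kappa> \<in> K" "\<And>i. \<kappa> = Inl (Inl i) \<Longrightarrow> i \<in> ?I \<Longrightarrow> thesis"
    "\<And>j js. \<kappa> = Inl (Inr (j, js)) \<Longrightarrow> j \<in> ?I \<Longrightarrow> set js \<subseteq> ?I \<Longrightarrow> length js \<le> k \<Longrightarrow> thesis"
    "\<And>j. \<kappa> = Inr j \<Longrightarrow> j \<in> idx Y \<Longrightarrow> thesis" for \<kappa> thesis
    using that unfolding K_def jet_idx_def by fast
  \<comment> \<open>The conditions shared by the two pairs (\<eta>, \<phi>) and (\<eta>', \<phi>'),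
    so that smoothness and openness are shown once for both.\<close>
  define good where "good \<sigma> \<psi> \<longleftrightarrow> \<sigma> \<in> carrier (Diff X) \<and> smooth_map_on X Y W \<psi> \<and>
    (\<forall>p\<in>S0. \<psi> (?i p) \<in> V \<and> \<pi> (\<psi> (?i p)) = ?i p \<and> \<sigma> (?i p) \<in> U')" for \<sigma> \<psi>
  have good: "good \<eta> \<phi>" "good \<eta>' \<phi>'"
    using \<eta> \<eta>' \<phi> \<phi>' inS0 by (auto simp: good_def)
  have CG: "G \<sigma> \<psi> \<kappa> p = C \<sigma> (\<psi> (?i p)) \<kappa>" if "good \<sigma> \<psi>" "\<kappa> \<in> K" "p \<in> S0" for \<sigma> \<psi> \<kappa> p
    using that inS0[OF that(3)]
    by (cases \<kappa>) (auto simp: C_def G_def good_def K_def jet_coords_def split: sum.split)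
  have Csm: "smooth_real_on ?I S0 (\<lambda>p. C \<sigma> (\<psi> (?i p)) \<kappa>)" if g: "good \<sigma> \<psi>" and \<kappa>: "\<kappa> \<in> K" for \<sigma> \<psi> \<kappa>
  proof (rule smooth_cong[OF fI S0 CG[OF g \<kappa>]])
    have s\<sigma>: "smooth_map_on X X (pts X) \<sigma>" and s\<psi>: "smooth_map_on X Y W \<psi>"
      using g DiffD(4) by (auto simp: good_def)
    have gp: "\<psi> (?i p) \<in> V" "\<sigma> (?i p) \<in> U'" if "p \<in> S0" for p using g that by (auto simp: good_def)
    have sub: "S0 \<subseteq> a ` (U \<inter> {z \<in> W. \<psi> z \<in> V})" "S0 \<subseteq> a ` (U \<inter> {z \<in> pts X. \<sigma> z \<in> U'})"
    proof -
      have "p \<in> a ` (U \<inter> {z \<in> W. \<psi> z \<in> V}) \<and> p \<in> a ` (U \<inter> {z \<in> pts X. \<sigma> z \<in> U'})" if "p \<in> S0" for p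
        using inS0[OF that] gp[OF that] image_eqI[of p a "?i p"] by auto
      then show "S0 \<subseteq> a ` (U \<inter> {z \<in> W. \<psi> z \<in> V})" "S0 \<subseteq> a ` (U \<inter> {z \<in> pts X. \<sigma> z \<in> U'})" by blast+
    qed
    from \<kappa> show "smooth_real_on ?I S0 (G \<sigma> \<psi> \<kappa>)"
    proof (cases rule: K_cases)
      case (1 i)
      then show ?thesis by (simp add: G_def smooth_coord)
    next
      case (2 i js)
      have "smooth_real_on ?I S0 (\<lambda>p. a' (\<sigma> (?i p)) i)"
        by (rule smooth_subset[OF smooth_fun_onD[OF smooth_map_onD(5)[OF s\<sigma> U'(1) 2(2)] U] sub(2)])
      with 2 show ?thesis by (simp add: G_def smooth_iter_pd)
    next
      case (3 i)
      have "smooth_real_on ?I S0 (\<lambda>p. b (\<psi> (?i p)) i)"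
        by (rule smooth_subset[OF smooth_fun_onD[OF smooth_map_onD(5)[OF s\<psi> V(1) 3(2)] U] sub(1)])
      with 3 show ?thesis by (simp add: G_def)
    qed
  qed
  \<comment> \<open>Continuity into \<open>powertop_real K\<close> requires extensional values; the
    restriction in \<open>jet_coords\<close> and the chart b supply them.\<close>
  have Cext: "C \<sigma> (\<psi> (?i p)) \<in> extensional K" if g: "good \<sigma> \<psi>" and p: "p \<in> S0" for \<sigma> \<psi> p
  proof -
    have "b (\<psi> (?i p)) \<in> extensional (idx Y)"
      by (rule opn_extensional[OF chartD(4)[OF Y V(1)]]) (use g p in \<open>auto simp: good_def\<close>)
    then show ?thesis
      by (auto simp: C_def K_def extensional_def jet_coords_def restrict_def split: sum.split)
  qed
  have oB: "opn ?I {p \<in> S0. C \<sigma> (\<psi> (?i p)) \<in> B}" if g: "good \<sigma> \<psi>" for \<sigma> \<psi>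
  proof -
    have t: "topspace (subtopology (powertop_real ?I) S0) = S0" using openin_subset[OF S0] by auto
    have "continuous_map (subtopology (powertop_real ?I) S0) (powertop_real K) (\<lambda>p. C \<sigma> (\<psi> (?i p)))"
      unfolding continuous_map_componentwise t
      using Cext[OF g] smooth_continuous[OF Csm[OF g]] by auto
    from openin_continuous_map_preimage[OF this B(1)] S0 show ?thesis
      unfolding t by (rule openin_trans_full)
  qed
  let ?C1 = "\<lambda>p. C \<eta> (\<phi> (?i p))" and ?C2 = "\<lambda>p. C \<eta>' (\<phi>' (?i p))"
  \<comment> \<open>Base coordinates are identical; a derivative of \<eta> of order at most k leaves
    r of the k + r orders; for the fibre coordinates r of the k + r orders of \<phi> are
    used.\<close>
  have Cjeq: "partials_agree r ?I (a x) (\<lambda>p. ?C1 p \<kappa>) (\<lambda>p. ?C2 p \<kappa>)" if \<kappa>: "\<kappa> \<in> K" for \<kappa>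
  proof -
    have "partials_agree r ?I (a x) (G \<eta> \<phi> \<kappa>) (G \<eta>' \<phi>' \<kappa>)"
      using \<kappa>
    proof (cases rule: K_cases)
      case (1 i)
      then show ?thesis by (simp add: G_def partials_agree_refl)
    next
      case (2 i js)
      with partials_agree_iter_pd[OF same_jetD(2)[OF j\<eta> U U'(1) xU U'(2) 2(2)] 2(3,4)] show ?thesis
        by (simp add: G_def)
    next
      case (3 i)
      with partials_agree_mono[OF same_jetD(2)[OF j\<phi> U V(1) xU V(2) 3(2)], of r] show ?thesis
        by (simp add: G_def)
    qed
    moreover have "partials_agree r ?I (a x) (\<lambda>p. ?C1 p \<kappa>) (G \<eta> \<phi> \<kappa>)"
      by (rule partials_agree_cong[OF fI S0 ax CG[OF good(1) \<kappa>, symmetric]])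
    moreover have "partials_agree r ?I (a x) (G \<eta>' \<phi>' \<kappa>) (\<lambda>p. ?C2 p \<kappa>)"
      by (rule partials_agree_cong[OF fI S0 ax CG[OF good(2) \<kappa>]])
    ultimately show ?thesis by (meson partials_agree_trans)
  qed
  have C12: "?C1 (a x) = ?C2 (a x)"
    by (rule extensionalityI[OF Cext[OF good(1) ax] Cext[OF good(2) ax]]) (rule partials_agree_value[OF Cjeq])
  \<comment> \<open>Here the coordinates of both pairs lie in B, where l represents the
    action.\<close>
  let ?S = "{p \<in> S0. ?C1 p \<in> B} \<inter> {p \<in> S0. ?C2 p \<in> B}"
  have S: "opn ?I ?S" by (rule openin_Int[OF oB[OF good(1)] oB[OF good(2)]])
  have C1B: "?C1 (a x) \<in> B" unfolding ix by (rule B(2))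
  have axS: "a x \<in> ?S" using ax C1B C12 by simp
  have "partials_agree r ?I (a x) (\<lambda>p. l j (?C1 p)) (\<lambda>p. l j (?C2 p))"
    by (rule partials_agree_compose[of ?I K ?S B "a x" ?C1 ?C2 r "l j" "l j",
          OF fI fK S B(1) axS _ _ C12 _ _ Cjeq l[OF j] l[OF j] partials_agree_refl])
      (auto intro: smooth_subset[OF Csm[OF good(1)]] smooth_subset[OF Csm[OF good(2)]])
  moreover have Dm: "(\<sigma>, \<psi> (?i p)) \<in> D" if "good \<sigma> \<psi>" "p \<in> S0" for \<sigma> \<psi> p
    using that inS0[OF that(2)] by (auto simp: good_def D_def)
  have "partials_agree r ?I (a x) (\<lambda>p. b2 (A \<eta> (\<phi> (?i p))) j) (\<lambda>p. l j (?C1 p))"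
    by (rule partials_agree_cong[OF fI S axS]) (rule Al[OF Dm[OF good(1)]], auto)
  moreover have "partials_agree r ?I (a x) (\<lambda>p. l j (?C2 p)) (\<lambda>p. b2 (A \<eta>' (\<phi>' (?i p))) j)"
    by (rule partials_agree_cong[OF fI S axS]) (rule Al[OF Dm[OF good(2)], symmetric], auto)
  ultimately show "partials_agree r ?I (a x) (\<lambda>p. b2 (A \<eta> (\<phi> (?i p))) j) (\<lambda>p. b2 (A \<eta>' (\<phi>' (?i p))) j)"
    by (meson partials_agree_trans)
qed

section \<open>Jets as equivalence classes and independence of representatives\<close>

lemma jet_eqI:
  assumes "same_jet r X Y f g x"
  shows "jet r X Y \<pi> f x = jet r X Y \<pi> g x"
proof -
  have "same_jet r X Y f h x \<longleftrightarrow> same_jet r X Y g h x" for h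
    using same_jet_trans[OF assms] same_jet_trans[OF same_jet_sym[OF assms]] by blast
  then show ?thesis by (simp add: jet_def)
qed

text \<open>Being a local section, g is a member of its own class, hence of that of f. This excludes
  the case of two empty classes, whose equality would say nothing.\<close>

lemma jet_eqD:
  assumes "jet r X Y \<pi> f x = jet r X Y \<pi> g y" "local_section X Y \<pi> g y"
  shows "x = y" "same_jet r X Y f g x"
proof -
  have c: "x = y \<and> {\<psi>. local_section X Y \<pi> \<psi> x \<and> same_jet r X Y f \<psi> x} =
      {\<psi>. local_section X Y \<pi> \<psi> y \<and> same_jet r X Y g \<psi> y}"
    using assms(1) unfolding jet_def prod.inject .
  note e = conjunct1[OF c] conjunct2[OF c]
  show "x = y" by (rule e(1))
  have "g \<in> {\<psi>. local_section X Y \<pi> \<psi> y \<and> same_jet r X Y g \<psi> y}"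
    by (simp add: assms(2) same_jet_refl)
  then show "same_jet r X Y f g x" unfolding e(2)[symmetric] by simp
qed

lemma local_sectionE:
  assumes "local_section X Y \<pi> \<phi> x"
  obtains W where "x \<in> W" "smooth_map_on X Y W \<phi>" "\<And>z. z \<in> W \<Longrightarrow> \<pi> (\<phi> z) = z"
  using assms unfolding local_section_def by blast

lemma local_section_pair:
  assumes "\<eta> \<in> carrier (Diff X)" "local_section X Y \<pi> \<phi> x"
  shows "local_section X (Ytilde X Y \<pi>) fst (pair_section \<eta> \<phi>) x"
proof -
  obtain W where W: "x \<in> W" "smooth_map_on X Y W \<phi>" "\<And>z. z \<in> W \<Longrightarrow> \<pi> (\<phi> z) = z"
    using local_sectionE[OF assms(2)] by blast
  have "smooth_map_on X X W \<eta>"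
    by (rule smooth_map_on_subset[OF DiffD(4)[OF assms(1)] smooth_map_onD(3,1)[OF W(2)]])
  from smooth_map_pair_section[OF this W(2,3)] W(1) show ?thesis
    unfolding local_section_def by (auto simp: pair_section_def)
qed

lemma same_jet_pair:
  assumes X: "smooth_manifold X" and Y: "smooth_manifold Y"
    and \<eta>: "\<eta> \<in> carrier (Diff X)" and \<phi>: "local_section X Y \<pi> \<phi> x"
    and e: "same_jet r X (Ytilde X Y \<pi>) (pair_section \<eta> \<phi>) (pair_section \<eta>' \<phi>') x"
  shows "same_jet r X X \<eta> \<eta>' x" "same_jet r X Y \<phi> \<phi>' x"
proof -
  obtain W where W: "x \<in> W" "smooth_map_on X Y W \<phi>" "\<And>z. z \<in> W \<Longrightarrow> \<pi> (\<phi> z) = z"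
    using local_sectionE[OF \<phi>] by blast
  have "x \<in> pts X" using smooth_map_onD(3)[OF W(2)] W(1) by blast
  then have "fst (snd (pair_section \<eta> \<phi> x)) \<in> pts X" "snd (snd (pair_section \<eta> \<phi> x)) \<in> pts Y"
    "\<pi> (snd (snd (pair_section \<eta> \<phi> x))) = fst (pair_section \<eta> \<phi> x)"
    using Diff_apply(1)[OF \<eta>] smooth_map_onD(4)[OF W(2,1)] W(3)[OF W(1)] by (simp_all add: pair_section_def)
  from same_jet_YtildeD[OF X Y e this]
  show "same_jet r X X \<eta> \<eta>' x" "same_jet r X Y \<phi> \<phi>' x" by (simp_all add: pair_section_def)
qed

text \<open>At \<eta> x three results meet: inversion of jets for the inverse diffeomorphisms, the
  differential index for the action along the fields, and composition. The full order k + r is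
  consumed by the action; the inverses contribute r-jets.\<close>

lemma same_jet_transformed:
  fixes X :: "('x, nat) manifold" and Y :: "('y, 'j) manifold"
  assumes X: "smooth_manifold X" and Y: "smooth_manifold Y" and di: "differential_index k X Y \<pi> A"
    and \<eta>: "\<eta> \<in> carrier (Diff X)" and \<eta>': "\<eta>' \<in> carrier (Diff X)"
    and A: "A \<eta> \<in> carrier (Diff Y)" and A': "A \<eta>' \<in> carrier (Diff Y)"
    and \<phi>: "local_section X Y \<pi> \<phi> x" and \<phi>': "local_section X Y \<pi> \<phi>' x"
    and j\<eta>: "same_jet (k + r) X X \<eta> \<eta>' x" and j\<phi>: "same_jet (k + r) X Y \<phi> \<phi>' x"
  shows "same_jet r X Y (A \<eta> \<circ> \<phi> \<circ> inv_into (pts X) \<eta>) (A \<eta>' \<circ> \<phi>' \<circ> inv_into (pts X) \<eta>') (\<eta> x)"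
proof -
  obtain W1 where W1: "x \<in> W1" "smooth_map_on X Y W1 \<phi>" "\<And>z. z \<in> W1 \<Longrightarrow> \<pi> (\<phi> z) = z"
    using local_sectionE[OF \<phi>] by blast
  obtain W2 where W2: "x \<in> W2" "smooth_map_on X Y W2 \<phi>'" "\<And>z. z \<in> W2 \<Longrightarrow> \<pi> (\<phi>' z) = z"
    using local_sectionE[OF \<phi>'] by blast
  define W where "W = W1 \<inter> W2"
  have W: "openin (mtop X) W" "x \<in> W"
    using smooth_map_onD(1)[OF W1(2)] smooth_map_onD(1)[OF W2(2)] W1(1) W2(1) by (auto simp: W_def)
  have s: "smooth_map_on X Y W \<phi>" and s': "smooth_map_on X Y W \<phi>'"
    using smooth_map_on_subset[OF W1(2) _ W(1)] smooth_map_on_subset[OF W2(2) _ W(1)] by (auto simp: W_def)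
  have \<pi>: "\<pi> (\<phi> z) = z" "\<pi> (\<phi>' z) = z" if "z \<in> W" for z using W1(3) W2(3) that by (auto simp: W_def)
  have x: "x \<in> pts X" using smooth_map_onD(3)[OF s] W(2) by blast
  let ?g = "inv_into (pts X) \<eta>" and ?g' = "inv_into (pts X) \<eta>'"
  note ap = Diff_apply[OF \<eta>] and ap' = Diff_apply[OF \<eta>']
  have "same_jet r X X \<eta> \<eta>' x" by (rule same_jet_mono[OF j\<eta>]) simp
  then have g: "same_jet r X X ?g ?g' (\<eta> x)"
    by (intro same_jet_inverse[OF X X DiffD(4)[OF \<eta>] DiffD(4)[OF \<eta>'] x DiffD(5)[OF \<eta>] DiffD(5)[OF \<eta>']])
      (simp_all add: ap ap' x)
  have "same_jet r X Y (\<lambda>z. A \<eta> (\<phi> z)) (\<lambda>z. A \<eta>' (\<phi>' z)) (?g (\<eta> x))"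
    unfolding ap(4)[OF x] by (rule same_jet_action[OF X Y di \<eta> \<eta>' s \<pi>(1) s' \<pi>(2) W(2) j\<eta> j\<phi>])
  moreover have "smooth_map_on X Y W (\<lambda>z. A \<eta> (\<phi> z))"
    by (rule smooth_map_on_compose[OF X Y Y s DiffD(4)[OF A] smooth_map_onD(4)[OF s]])
  moreover have "smooth_map_on X Y W (\<lambda>z. A \<eta>' (\<phi>' z))"
    by (rule smooth_map_on_compose[OF X Y Y s' DiffD(4)[OF A'] smooth_map_onD(4)[OF s']])
  moreover have "?g (\<eta> x) \<in> W" using ap(4)[OF x] W(2) by simp
  ultimately show ?thesis unfolding o_def
    using same_jet_compose[OF X X Y DiffD(5)[OF \<eta>] DiffD(5)[OF \<eta>'] ap(1)[OF x] g] by blast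
qed

lemma covariantized_depends_only_on_jet:
  fixes X :: "('x, nat) manifold" and Y :: "('y, 'j) manifold"
  assumes X: "smooth_manifold X" and Y: "smooth_manifold Y" and di: "differential_index k X Y \<pi> A"
    and A: "\<And>\<eta>. \<eta> \<in> carrier (Diff X) \<Longrightarrow> A \<eta> \<in> carrier (Diff Y)" and kr: "k + r > 0"
  shows "depends_only_on_jet k r X Y \<pi> A L"
  unfolding depends_only_on_jet_def
proof (intro ballI allI impI, elim conjE)
  fix \<eta> \<eta>' \<phi> \<phi>' x
  assume \<eta>: "\<eta> \<in> carrier (Diff X)" and \<eta>': "\<eta>' \<in> carrier (Diff X)" and x: "x \<in> pts X"
    and \<phi>: "local_section X Y \<pi> \<phi> x" and \<phi>': "local_section X Y \<pi> \<phi>' x"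
    and "jet (k + r) X (Ytilde X Y \<pi>) fst (pair_section \<eta> \<phi>) x =
        jet (k + r) X (Ytilde X Y \<pi>) fst (pair_section \<eta>' \<phi>') x"
  then have "same_jet (k + r) X (Ytilde X Y \<pi>) (pair_section \<eta> \<phi>) (pair_section \<eta>' \<phi>') x"
    by (intro jet_eqD(2)[OF _ local_section_pair])
  note j = same_jet_pair[OF X Y \<eta> \<phi> this]
  \<comment> \<open>The one place where the order must be positive: the pull-back of forms needs the
    first derivative of \<eta>.\<close>
  have "same_jet 1 X X \<eta> \<eta>' x" by (rule same_jet_mono[OF j(1)]) (use kr in linarith)
  note p = pull_form_jet[OF X DiffD(4)[OF \<eta>] DiffD(4)[OF \<eta>'] x this]
  show "covariantized r X Y \<pi> A L \<eta> \<phi> x = covariantized r X Y \<pi> A L \<eta>' \<phi>' x"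
    unfolding covariantized_def p
    using jet_eqI[OF same_jet_transformed[OF X Y di \<eta> \<eta>' A[OF \<eta>] A[OF \<eta>'] \<phi> \<phi>' j], of \<pi>]
      same_jetD(1)[OF j(1)] by simp
qed

lemma Ltilde_jet:
  assumes "depends_only_on_jet k r X Y \<pi> A L"
    and "\<eta> \<in> carrier (Diff X)" "local_section X Y \<pi> \<phi> x" "x \<in> pts X"
  shows "Ltilde k r X Y \<pi> A L (jet (k + r) X (Ytilde X Y \<pi>) fst (pair_section \<eta> \<phi>) x) =
    covariantized r X Y \<pi> A L \<eta> \<phi> x"
  unfolding Ltilde_def
proof (rule the_equality)
  fix \<omega>
  assume "\<exists>\<eta>'\<in>carrier (Diff X). \<exists>\<phi>' x'. x' \<in> pts X \<and> local_section X Y \<pi> \<phi>' x' \<and>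
     jet (k + r) X (Ytilde X Y \<pi>) fst (pair_section \<eta> \<phi>) x =
       jet (k + r) X (Ytilde X Y \<pi>) fst (pair_section \<eta>' \<phi>') x' \<and>
     \<omega> = covariantized r X Y \<pi> A L \<eta>' \<phi>' x'"
  then obtain \<eta>' \<phi>' x' where *: "\<eta>' \<in> carrier (Diff X)" "x' \<in> pts X" "local_section X Y \<pi> \<phi>' x'"
    "jet (k + r) X (Ytilde X Y \<pi>) fst (pair_section \<eta> \<phi>) x =
       jet (k + r) X (Ytilde X Y \<pi>) fst (pair_section \<eta>' \<phi>') x'"
    "\<omega> = covariantized r X Y \<pi> A L \<eta>' \<phi>' x'" by blast
  have x': "x' = x" using *(4) by (simp add: jet_def)
  show "\<omega> = covariantized r X Y \<pi> A L \<eta> \<phi> x"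
    using assms(1)[unfolded depends_only_on_jet_def, rule_format, OF assms(2) *(1) assms(4)
        conjI[OF assms(3) conjI[OF *(3,4)[unfolded x']]]] *(5) x' by simp
next
  show "\<exists>\<eta>'\<in>carrier (Diff X). \<exists>\<phi>' x'. x' \<in> pts X \<and> local_section X Y \<pi> \<phi>' x' \<and>
     jet (k + r) X (Ytilde X Y \<pi>) fst (pair_section \<eta> \<phi>) x =
       jet (k + r) X (Ytilde X Y \<pi>) fst (pair_section \<eta>' \<phi>') x' \<and>
     covariantized r X Y \<pi> A L \<eta> \<phi> x = covariantized r X Y \<pi> A L \<eta>' \<phi>' x'"
    using assms(2-4) by (intro bexI[of _ \<eta>] exI[of _ \<phi>] exI[of _ x] conjI refl)
qed

text \<open>The description in \<open>prolong\<close> ranges over all local sections of the fibre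
  product, so \<psi> is not restricted to pairs with a diffeomorphism. Two representatives are
  composed with the same maps, the inverse of \<sigma> inside and, for the last entry,
  \<open>A \<sigma>\<close> outside, so composition of jets applies entry by entry.\<close>

lemma prolong_jet:
  assumes X: "smooth_manifold X" and Y: "smooth_manifold Y"
    and \<sigma>: "\<sigma> \<in> carrier (Diff X)" and A: "A \<sigma> \<in> carrier (Diff Y)"
    and \<psi>: "local_section X (Ytilde X Y \<pi>) fst \<psi> x"
  shows "prolong m X (Ytilde X Y \<pi>) fst (act_tilde A \<sigma>) \<sigma> (jet m X (Ytilde X Y \<pi>) fst \<psi> x) =
    jet m X (Ytilde X Y \<pi>) fst (act_tilde A \<sigma> \<circ> \<psi> \<circ> inv_into (pts X) \<sigma>) (\<sigma> x)"
  unfolding prolong_def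
proof (rule the_equality)
  let ?Y = "Ytilde X Y \<pi>" and ?g = "inv_into (pts X) \<sigma>"
  obtain W1 where W1: "x \<in> W1" "smooth_map_on X ?Y W1 \<psi>" by (rule local_sectionE[OF \<psi>])
  have x: "x \<in> pts X" using smooth_map_onD(3)[OF W1(2)] W1(1) by blast
  then show "\<exists>\<psi>' x'. x' \<in> pts X \<and> local_section X ?Y fst \<psi>' x' \<and>
      jet m X ?Y fst \<psi> x = jet m X ?Y fst \<psi>' x' \<and>
      jet m X ?Y fst (act_tilde A \<sigma> \<circ> \<psi> \<circ> ?g) (\<sigma> x) =
      jet m X ?Y fst (act_tilde A \<sigma> \<circ> \<psi>' \<circ> ?g) (\<sigma> x')"
    using \<psi> by (intro exI[of _ \<psi>] exI[of _ x] conjI refl)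
  fix \<delta>
  assume "\<exists>\<psi>' x'. x' \<in> pts X \<and> local_section X ?Y fst \<psi>' x' \<and>
      jet m X ?Y fst \<psi> x = jet m X ?Y fst \<psi>' x' \<and>
      \<delta> = jet m X ?Y fst (act_tilde A \<sigma> \<circ> \<psi>' \<circ> ?g) (\<sigma> x')"
  then obtain \<psi>' x' where *: "local_section X ?Y fst \<psi>' x'" "jet m X ?Y fst \<psi> x = jet m X ?Y fst \<psi>' x'"
    "\<delta> = jet m X ?Y fst (act_tilde A \<sigma> \<circ> \<psi>' \<circ> ?g) (\<sigma> x')" by blast
  note e = jet_eqD[OF *(2,1)]
  obtain W2 where W2: "x \<in> W2" "smooth_map_on X ?Y W2 \<psi>'"
    by (rule local_sectionE[OF *(1)[folded e(1)]])
  define W where "W = W1 \<inter> W2"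
  have W: "openin (mtop X) W" "x \<in> W"
    using smooth_map_onD(1)[OF W1(2)] smooth_map_onD(1)[OF W2(2)] W1(1) W2(1) by (auto simp: W_def)
  have s: "smooth_map_on X ?Y W \<psi>" and s': "smooth_map_on X ?Y W \<psi>'"
    using smooth_map_on_subset[OF W1(2) _ W(1)] smooth_map_on_subset[OF W2(2) _ W(1)] by (auto simp: W_def)
  note c = smooth_map_Ytilde_components[OF X Y s] and c' = smooth_map_Ytilde_components[OF X Y s']
  note j = same_jet_YtildeD[OF X Y e(2) smooth_map_onD(4)[OF c(2) W(2)] smooth_map_onD(4)[OF c(3) W(2)] c(1)[OF W(2)]]
  have g: "?g (\<sigma> x) = x" by (rule Diff_apply(4)[OF \<sigma> x])
  have gW: "?g (\<sigma> x) \<in> W" using g W(2) by simp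
  have act: "fst (act_tilde A \<sigma> p) = \<sigma> (fst p)" "fst (snd (act_tilde A \<sigma> p)) = fst (snd p)"
    "snd (snd (act_tilde A \<sigma> p)) = A \<sigma> (snd (snd p))" for p
    by (auto simp: act_tilde_def split_beta)
  have "same_jet m X ?Y (act_tilde A \<sigma> \<circ> \<psi> \<circ> ?g) (act_tilde A \<sigma> \<circ> \<psi>' \<circ> ?g) (\<sigma> x)"
  proof (rule same_jet_YtildeI; unfold o_def act)
    note g_smooth = DiffD(5)[OF \<sigma>] DiffD(5)[OF \<sigma>] Diff_apply(1)[OF \<sigma> x] same_jet_refl
    show "\<sigma> (fst (\<psi> (?g (\<sigma> x)))) = \<sigma> (fst (\<psi>' (?g (\<sigma> x))))"
      unfolding g using same_jetD(1)[OF e(2)] by simp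
    show "same_jet m X X (\<lambda>z. fst (snd (\<psi> (?g z)))) (\<lambda>z. fst (snd (\<psi>' (?g z)))) (\<sigma> x)"
      by (rule same_jet_compose[OF X X X g_smooth c(2) c'(2) gW]) (simp add: g j(1))
    have j2: "same_jet m X Y (\<lambda>z. snd (snd (\<psi> (?g z)))) (\<lambda>z. snd (snd (\<psi>' (?g z)))) (\<sigma> x)"
      by (rule same_jet_compose[OF X X Y g_smooth c(3) c'(3) gW]) (simp add: g j(2))
    \<comment> \<open>The inverse of \<sigma> is restricted to where it lands in W, the common
      domain of the two representatives.\<close>
    have sm: "smooth_map_on X Y {z \<in> pts X. ?g z \<in> W} (\<lambda>z. snd (snd (h (?g z))))"
      if "smooth_map_on X Y W (\<lambda>z. snd (snd (h z)))" for h
    proof (rule smooth_map_on_compose[OF X X Y _ that])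
      show "smooth_map_on X X {z \<in> pts X. ?g z \<in> W} ?g"
        by (rule smooth_map_on_subset[OF DiffD(5)[OF \<sigma>] _ open_preimage[OF DiffD(5)[OF \<sigma>] W(1)]]) auto
    qed simp
    have mem: "\<sigma> x \<in> {z \<in> pts X. ?g z \<in> W}" using Diff_apply(1)[OF \<sigma> x] gW by simp
    show "same_jet m X Y (\<lambda>z. A \<sigma> (snd (snd (\<psi> (?g z))))) (\<lambda>z. A \<sigma> (snd (snd (\<psi>' (?g z))))) (\<sigma> x)"
      by (rule same_jet_compose[OF X Y Y sm[OF c(3)] sm[OF c'(3)] mem j2 DiffD(4)[OF A] DiffD(4)[OF A]
            smooth_map_onD(4)[OF c(3) gW] same_jet_refl])
  qed
  then show "\<delta> = jet m X ?Y fst (act_tilde A \<sigma> \<circ> \<psi> \<circ> ?g) (\<sigma> x)"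
    using *(3) e(1) jet_eqI by metis
qed

lemma covariantized_transformed:
  fixes X :: "('x, nat) manifold" and Y :: "('y, 'j) manifold"
  assumes X: "smooth_manifold X" and Y: "smooth_manifold Y"
    and hom: "A \<in> hom (Diff X) (Aut X Y \<pi>)"
    and \<sigma>: "\<sigma> \<in> carrier (Diff X)" and \<eta>: "\<eta> \<in> carrier (Diff X)"
    and \<phi>: "local_section X Y \<pi> \<phi> x" and x: "x \<in> pts X"
  shows "covariantized r X Y \<pi> A L (compose (pts X) \<eta> (restrict (inv_into (pts X) \<sigma>) (pts X)))
      (A \<sigma> \<circ> \<phi> \<circ> inv_into (pts X) \<sigma>) (\<sigma> x) =
    push_form X \<sigma> x (covariantized r X Y \<pi> A L \<eta> \<phi> x)"
proof -
  let ?P = "pts X"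
  let ?\<tau> = "inv_into ?P \<sigma>"
  define \<zeta> where "\<zeta> = compose ?P \<eta> (restrict ?\<tau> ?P)"
  note as = Diff_apply[OF \<sigma>] and ae = Diff_apply[OF \<eta>]
  have \<zeta>: "\<zeta> \<in> carrier (Diff X)" unfolding \<zeta>_def by (rule compose_Diff[OF X \<eta> inv_Diff[OF X \<sigma>]])
  note az = Diff_apply[OF \<zeta>]
  have \<zeta>z: "\<zeta> z = \<eta> (?\<tau> z)" if "z \<in> ?P" for z using that by (simp add: \<zeta>_def compose_eq)
  \<comment> \<open>An equality of functions, including the values outside X, because the
    homomorphism property of A speaks about group elements.\<close>
  have "compose ?P \<zeta> \<sigma> = \<eta>"
    by (rule extensionalityI[OF compose_extensional DiffD(2)[OF \<eta>]]) (simp add: compose_eq \<zeta>z as)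
  then have "\<eta> = \<zeta> \<otimes>\<^bsub>Diff X\<^esub> \<sigma>"
    using DiffD(3)[OF \<zeta>] DiffD(3)[OF \<sigma>] by (simp add: Diff_def BijGroup_def)
  then have "A \<eta> = A \<zeta> \<otimes>\<^bsub>Aut X Y \<pi>\<^esub> A \<sigma>" using hom_mult[OF hom \<zeta> \<sigma>] by simp
  moreover have "A \<zeta> \<in> Bij (pts Y)" "A \<sigma> \<in> Bij (pts Y)"
    using hom_carrier[OF hom] \<zeta> \<sigma> DiffD(3)[of _ Y] by (auto simp: Aut_def)
  ultimately have A: "A \<zeta> (A \<sigma> y) = A \<eta> y" if "y \<in> pts Y" for y
    using that by (simp add: Aut_def Diff_def BijGroup_def compose_eq)
  obtain W where W: "x \<in> W" "smooth_map_on X Y W \<phi>" by (rule local_sectionE[OF \<phi>])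
  \<comment> \<open>An open neighbourhood of \<eta> x on which \<phi> is evaluated inside W only.
    There its values lie in Y, where the composition law of the action is available.\<close>
  let ?N = "{z \<in> ?P. inv_into ?P \<eta> z \<in> W}"
  have "same_jet r X Y (A \<zeta> \<circ> (A \<sigma> \<circ> \<phi> \<circ> ?\<tau>) \<circ> inv_into ?P \<zeta>) (A \<eta> \<circ> \<phi> \<circ> inv_into ?P \<eta>) (\<eta> x)"
  proof (rule same_jet_cong[OF X open_preimage[OF DiffD(5)[OF \<eta>] smooth_map_onD(1)[OF W(2)]]])
    show "\<eta> x \<in> ?N" using ae x W(1) by simp
    fix z assume z: "z \<in> ?N"
    have "\<zeta> (\<sigma> (inv_into ?P \<eta> z)) = z" using z as ae by (simp add: \<zeta>z)
    then have "inv_into ?P \<zeta> z = \<sigma> (inv_into ?P \<eta> z)"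
      using z as(1) ae(2) az(4) by (metis (no_types, lifting) mem_Collect_eq)
    then show "(A \<zeta> \<circ> (A \<sigma> \<circ> \<phi> \<circ> ?\<tau>) \<circ> inv_into ?P \<zeta>) z = (A \<eta> \<circ> \<phi> \<circ> inv_into ?P \<eta>) z"
      using z ae as A smooth_map_onD(4)[OF W(2)] by simp
  qed
  then have j: "jet r X Y \<pi> (A \<zeta> \<circ> (A \<sigma> \<circ> \<phi> \<circ> ?\<tau>) \<circ> inv_into ?P \<zeta>) (\<eta> x) =
      jet r X Y \<pi> (A \<eta> \<circ> \<phi> \<circ> inv_into ?P \<eta>) (\<eta> x)" by (rule jet_eqI)
  have \<zeta>x: "\<zeta> (\<sigma> x) = \<eta> x" using x as by (simp add: \<zeta>z)
  \<comment> \<open>The outer pull-back, by the inverse of \<sigma> at \<sigma> x, is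
    \<open>push_form\<close> by \<sigma> at x.\<close>
  have "pull_form X \<zeta> (\<sigma> x) \<omega> = pull_form X ?\<tau> (\<sigma> x) (pull_form X \<eta> (?\<tau> (\<sigma> x)) \<omega>)" for \<omega>
    by (rule pull_form_compose[OF X DiffD(5)[OF \<sigma>] DiffD(4)[OF \<eta>] as(1)[OF x] as(2) \<zeta>z])
  then show ?thesis
    unfolding covariantized_def push_form_def \<zeta>_def[symmetric] \<zeta>x j by (simp add: as(4)[OF x])
qed

text \<open>The prolonged jet is again the jet of a pair of a diffeomorphism and a local section, so
  \<open>Ltilde_jet\<close> evaluates both sides and the claim becomes the identity for
  \<open>covariantized\<close>.\<close>

lemma Ltilde_covariant:
  fixes X :: "('x, nat) manifold" and Y :: "('y, 'j) manifold"
  assumes X: "smooth_manifold X" and Y: "smooth_manifold Y"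
    and hom: "A \<in> hom (Diff X) (Aut X Y \<pi>)"
    and cov: "\<And>\<sigma>. \<sigma> \<in> carrier (Diff X) \<Longrightarrow> covers Y \<pi> (A \<sigma>) \<sigma>"
    and dep: "depends_only_on_jet k r X Y \<pi> A L"
    and \<sigma>: "\<sigma> \<in> carrier (Diff X)" and \<eta>: "\<eta> \<in> carrier (Diff X)"
    and \<phi>: "local_section X Y \<pi> \<phi> x" and x: "x \<in> pts X"
  shows "Ltilde k r X Y \<pi> A L (prolong (k + r) X (Ytilde X Y \<pi>) fst (act_tilde A \<sigma>) \<sigma>
      (jet (k + r) X (Ytilde X Y \<pi>) fst (pair_section \<eta> \<phi>) x)) =
    push_form X \<sigma> x (Ltilde k r X Y \<pi> A L (jet (k + r) X (Ytilde X Y \<pi>) fst (pair_section \<eta> \<phi>) x))"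
proof -
  let ?P = "pts X"
  let ?\<tau> = "inv_into ?P \<sigma>"
  let ?\<zeta> = "compose ?P \<eta> (restrict ?\<tau> ?P)" and ?\<phi> = "A \<sigma> \<circ> \<phi> \<circ> ?\<tau>"
  note as = Diff_apply[OF \<sigma>]
  have A: "A \<sigma> \<in> carrier (Diff Y)" using hom_carrier[OF hom] \<sigma> by (auto simp: Aut_def)
  \<comment> \<open>Over a point z of X the first entry becomes \<sigma> applied to the preimage of
    z, which is z itself; thus the moved section has the form of a pair.\<close>
  have "same_jet (k + r) X (Ytilde X Y \<pi>) (act_tilde A \<sigma> \<circ> pair_section \<eta> \<phi> \<circ> ?\<tau>) (pair_section ?\<zeta> ?\<phi>) (\<sigma> x)"
    by (rule same_jet_cong[OF X openin_topspace as(1)[OF x]])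
      (simp add: act_tilde_def pair_section_def compose_eq as)
  with prolong_jet[where A = A and \<psi> = "pair_section \<eta> \<phi>" and m = "k + r", OF X Y \<sigma> A local_section_pair[OF \<eta> \<phi>]]
  have p: "prolong (k + r) X (Ytilde X Y \<pi>) fst (act_tilde A \<sigma>) \<sigma>
      (jet (k + r) X (Ytilde X Y \<pi>) fst (pair_section \<eta> \<phi>) x) =
    jet (k + r) X (Ytilde X Y \<pi>) fst (pair_section ?\<zeta> ?\<phi>) (\<sigma> x)"
    by (simp add: jet_eqI)
  obtain W where W: "x \<in> W" "smooth_map_on X Y W \<phi>" "\<And>z. z \<in> W \<Longrightarrow> \<pi> (\<phi> z) = z"
    using local_sectionE[OF \<phi>] by blast
  have "local_section X Y \<pi> ?\<phi> (\<sigma> x)"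
    unfolding local_section_def
  proof (intro exI[of _ "{z \<in> ?P. ?\<tau> z \<in> W}"] conjI ballI)
    show "\<sigma> x \<in> {z \<in> ?P. ?\<tau> z \<in> W}" using as x W(1) by simp
    have "smooth_map_on X X {z \<in> ?P. ?\<tau> z \<in> W} ?\<tau>"
      by (rule smooth_map_on_subset[OF DiffD(5)[OF \<sigma>] _ open_preimage[OF DiffD(5)[OF \<sigma>] smooth_map_onD(1)[OF W(2)]]]) auto
    from smooth_map_on_compose[OF X X Y this W(2)] have "smooth_map_on X Y {z \<in> ?P. ?\<tau> z \<in> W} (\<lambda>z. \<phi> (?\<tau> z))"
      by simp
    from smooth_map_on_compose[OF X Y Y this DiffD(4)[OF A] smooth_map_onD(4)[OF this]]
    show "smooth_map_on X Y {z \<in> ?P. ?\<tau> z \<in> W} ?\<phi>" by (simp add: o_def)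
    \<comment> \<open>The moved field is a section because \<open>A \<sigma>\<close> covers
      \<sigma>.\<close>
    show "\<pi> (?\<phi> z) = z" if "z \<in> {z \<in> ?P. ?\<tau> z \<in> W}" for z
      using that cov[OF \<sigma>] smooth_map_onD(4)[OF W(2)] W(3) as(3) by (simp add: covers_def)
  qed
  then show ?thesis
    unfolding p Ltilde_jet[OF dep \<eta> \<phi> x]
    using Ltilde_jet[OF dep compose_Diff[OF X \<eta> inv_Diff[OF X \<sigma>]] _ as(1)[OF x]]
      covariantized_transformed[OF X Y hom \<sigma> \<eta> \<phi> x] by simp
qed

theorem mainTheorem1:
  fixes X :: "('x, nat) manifold" and Y :: "('y, nat) manifold" and F :: "('f, nat) manifold"
    and \<pi> :: "'y \<Rightarrow> 'x" and Or :: "('x \<Rightarrow> 'x form) set"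
    and L :: "('x, 'y) jet \<Rightarrow> 'x form" and A :: "('x \<Rightarrow> 'x) \<Rightarrow> 'y \<Rightarrow> 'y"
    and n r k :: nat
  assumes "fibre_bundle X Y F \<pi>" and "card (idx X) = n + 1" and "orientation X Or"
    and "lagrangian_density r X Y \<pi> L"
    and "A \<in> hom (Diff X) (Aut X Y \<pi>)" and "inj_on A (carrier (Diff X))"
    and "\<forall>\<sigma>\<in>carrier (Diff X). covers Y \<pi> (A \<sigma>) \<sigma>"
    and "differential_index k X Y \<pi> A"
    and "k + r = 0 \<Longrightarrow> depends_only_on_jet k r X Y \<pi> A L"
  shows "\<forall>\<sigma>\<in>carrier (Diff X). \<forall>\<eta>\<in>carrier (Diff X). \<forall>x\<in>pts X. \<forall>\<phi> \<gamma>.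
    local_section X Y \<pi> \<phi> x \<longrightarrow>
    \<gamma> = jet (k + r) X (Ytilde X Y \<pi>) fst (pair_section \<eta> \<phi>) x \<longrightarrow>
    Ltilde k r X Y \<pi> A L (prolong (k + r) X (Ytilde X Y \<pi>) fst (act_tilde A \<sigma>) \<sigma> \<gamma>)
      = push_form X \<sigma> x (Ltilde k r X Y \<pi> A L \<gamma>)"
proof -
  have X: "smooth_manifold X" and Y: "smooth_manifold Y"
    using assms(1) by (auto simp: fibre_bundle_def)
  have A: "A \<sigma> \<in> carrier (Diff Y)" if "\<sigma> \<in> carrier (Diff X)" for \<sigma>
    using hom_carrier[OF assms(5)] that by (auto simp: Aut_def)
  have dep: "depends_only_on_jet k r X Y \<pi> A L"
  \<comment> \<open>In positive order the independence of the representative is a consequence of the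
    differential index; in order 0 it is the assumption.\<close>
  proof (cases "k + r = 0")
    case False
    then have "k + r > 0" by simp
    from covariantized_depends_only_on_jet[OF X Y assms(8) A this] show ?thesis .
  qed (rule assms(9))
  show ?thesis
  proof (intro ballI allI impI, hypsubst)
    fix \<sigma> \<eta> x \<phi>
    assume *: "\<sigma> \<in> carrier (Diff X)" "\<eta> \<in> carrier (Diff X)" "x \<in> pts X" "local_section X Y \<pi> \<phi> x"
    show "Ltilde k r X Y \<pi> A L (prolong (k + r) X (Ytilde X Y \<pi>) fst (act_tilde A \<sigma>) \<sigma>
        (jet (k + r) X (Ytilde X Y \<pi>) fst (pair_section \<eta> \<phi>) x)) =
      push_form X \<sigma> x (Ltilde k r X Y \<pi> A L (jet (k + r) X (Ytilde X Y \<pi>) fst (pair_section \<eta> \<phi>) x))"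
      by (rule Ltilde_covariant[OF X Y assms(5) bspec[OF assms(7)] dep *(1,2,4,3)])
  qed
qed

end
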